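(* $\Pi:\mathit{Tame\_Omega\_Cat}\to\mathit{Set}$ is a functor, where $\mathit{Tame\_Omega\_Cat}$ is the category of small weak omega categories and tame omega pseudo-functors, $\Pi\mathbf X$ is the set of $\approx$-equivalence classes of $0$-cells of $X_1$, and a tame omega pseudo-functor $\mathbf F$ acts through $F_1$.
   Context: A globular set $X$ is a sequence of sets $X_i$ ($i\ge 0$; elements are called $i$-cells) with functions $dom_{i-1}^i,cod_{i-1}^i:X_i\to X_{i-1}$ ($i>0$) satisfying $dom_{i-1}^i dom_i^{i+1}=dom_{i-1}^i cod_i^{i+1}$ and $cod_{i-1}^i dom_i^{i+1}=cod_{i-1}^i cod_i^{i+1}$. For $i<j$, $dom_i^j,cod_i^j:X_j\to X_i$ are the iterated composites. An omega graph is a globular set with functions $id_i^{i-1}:X_{i-1}\to X_i$ ($i>0$) with $dom_{i-1}^i id_i^{i-1}x=x=cod_{i-1}^i id_i^{i-1}x$; $id_j^i$ denotes the iterated composite $X_i\to X_j$. Cells in the image of $id_i^{i-1}$ are identity cells. An omega magma is an omega graph with, for all $0\le i<j$, a partial binary operation $a\circ_i^j b$ on $j$-cells, defined exactly when $cod_i^j a=dom_i^j b$, such that: if $i+1=j$, then $dom_i^j(a\circ_i^j b)=dom_i^j a$ and $cod_i^j(a\circ_i^j b)=cod_i^j b$; if $i+1<j$, then $dom_{j-1}^j(a\circ_i^j b)=dom_{j-1}^ja\circ_i^{j-1}dom_{j-1}^jb$ and likewise for $cod_{j-1}^j$. Morphisms of globular sets, omega graphs and omega magmas preserve all the respective structure.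 A strict omega category is an omega magma in which (whenever the composites are defined) $(a\circ_i^jb)\circ_i^jc=a\circ_i^j(b\circ_i^jc)$; $(a\circ_j^kb)\circ_i^k(c\circ_j^kd)=(a\circ_i^kc)\circ_j^k(b\circ_i^kd)$ for $i<j<k$; $a=id_j^i(dom_i^ja)\circ_i^ja=a\circ_i^jid_j^i(cod_i^ja)$; and $id_{j+1}^j(a)\circ_i^{j+1}id_{j+1}^j(b)=id_{j+1}^j(a\circ_i^jb)$ for $i<j$. Two $i$-cells $a,b$ are parallel, $a\parallel b$, if they have the same $dom_{i-1}^i$ and the same $cod_{i-1}^i$; any two $0$-cells are parallel. A bridge relation $R$ on an omega graph (or omega magma) $X$ is a sequence $R_i\subseteq X_i\times X_i\times X_{i+1}$ ($i\ge0$) such that: $(a,b,c)\in R_i$ implies $a\parallel b$, $dom_i^{i+1}c=a$, $cod_i^{i+1}c=b$; $(a,a,id_{i+1}^ia)\in R_i$ for all $a\in X_i$; $(a,b,c),(a,b,d)\in R_i$ implies $c=d$. The diagonal bridge relation $R^\Delta$ consists of all triples $(a,a,id_{i+1}^ia)$. A bridge morphism $F:(X,R^X)\to(Y,R^Y)$ is an omega magma morphism with $(a,b,c)\in R_i^X\Rightarrow(Fa,Fb,Fc)\in R_i^Y$. A categorical Penon morphism is a bridge morphism $F:(X,R^X)\to(Y,R^Y)$ such that $Y$ is a strict omega category, $R^Y=R^\Delta$; $(a,b,c)\in R_i^X$ implies $Fa=Fb$ and $Fc=id_{i+1}^i(Fa)$; and if $a,b\in X_i$, $a\parallel b$, $Fa=Fb$,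 then there is $c$ with $(a,b,c)\in R_i^X$. A weak omega category $\mathbf X$ consists of omega magmas $X_1$ (the underlying magma) and $X_2$, an omega magma morphism $\lambda^X:X_2\to X_1$, a morphism $\rho^X:X_1\to X_2$ of omega graphs with $\lambda^X\circ\rho^X=1$ (as omega graph morphisms), a bridge relation $R^X$ on $X_2$, a strict omega category $X_3$, and a categorical Penon morphism $\kappa^X:(X_2,R^X)\to(X_3,R^\Delta)$. An omega pseudo-functor $\mathbf F:\mathbf X\to\mathbf Y$ is a triple of morphisms of globular sets $F_i:X_i\to Y_i$ ($i=1,2,3$) such that $F_3$ is a morphism of omega graphs; $F_1\lambda^X=\lambda^YF_2$ and $F_3\kappa^X=\kappa^YF_2$ as morphisms of globular sets; and $\kappa^Y(F_2a\circ_{j-1}^jF_2b)=\kappa^YF_2(a\circ_{j-1}^jb)$ whenever $a\circ_{j-1}^jb$ is defined in $X_2$. Internal equivalences. An omega clique is an omega magma $M$ with a bridge relation $R^M$ such that for every parallel pair $a,b\in M_j$ there is $c$ with $(a,b,c)\in R_j^M$. Let $K(2)$ be the omega graph with exactly two $0$-cells $1,2$ and all other cells identities on these. $Cl(2)$ is the omega clique freely generated by $K(2)$: it comes with an omega graph morphism $K(2)\to Cl(2)$, and every omega graph morphism from $K(2)$ to an omega clique extends uniquely to a bridge morphism from $Cl(2)$. For $i,j\in\{1,2\}$ let $c(i,j)$ be the unique bridge $1$-cell from the $0$-cell $i$ to the $0$-cell $j$ given by the bridge relation of $Cl(2)$. For an omega magma $M$ and $(i-1)$-cells $a,b$, $M(a,b)$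 is the omega magma with $M(a,b)_j=\{c\in M_{i+j}: dom_{i-1}^{i+j}c=a,\ cod_{i-1}^{i+j}c=b\}$ and structure that of $M$ restricted and reindexed. A $1$-cell $f$ of $M$ is an elementary internal equivalence if it is an identity cell or there is an omega magma morphism $H:Cl(2)\to M$ with $H(c(1,2))=f$; for $i\ge2$ an $i$-cell $f$ is one if it is an identity cell or there is an omega magma morphism $H:Cl(2)\to M(dom_{i-2}^if,cod_{i-2}^if)$ with $H(c(1,2))=f$. $el(M)$ is the graded subset of these ($el(M)_0=\emptyset$). For a graded subset $S\subseteq M$, $\overline S$ is the smallest graded subset containing all (iterated) composites of elements of $S$, including the elements of $S$; and $T(S)$ is the smallest graded subset containing, for every $k\ge1$, every $f\in M_k$ for which there are $g\in M_k$ with $dom_{k-1}^kg=cod_{k-1}^kf$, $cod_{k-1}^kg=dom_{k-1}^kf$, and $h,h'\in S$ with $dom_k^{k+1}h=f\circ_{k-1}^kg$, $cod_k^{k+1}h=id_k^{k-1}dom_{k-1}^kf$, $dom_k^{k+1}h'=g\circ_{k-1}^kf$, $cod_k^{k+1}h'=id_k^{k-1}cod_{k-1}^kf$. Put $S_1(M)=\overline{el(M)}$, $S_i(M)=\overline{S_{i-1}(M)\cup T(S_{i-1}(M))}$ for $i\ge2$, and $Eq(M)=\bigcup_{i\ge1}S_i(M)$, the graded subset of internal equivalences. An omega pseudo-functor $\mathbf F:\mathbf X\to\mathbf Y$ is tame if $F_1(Eq(X_1))\subseteq Eq(Y_1)$. For $i$-cells $a,b$ of $X_1$ one sets $a\approx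 b$ iff there is $f\in Eq(X_1)_{i+1}$ with $dom_i^{i+1}f=a$ and $cod_i^{i+1}f=b$. *)

theory Defs
  imports "HOL-Library.FuncSet"
begin

section \<open>Globular sets, omega graphs, omega magmas, strict omega categories\<close>

text \<open>
  The components of these records are only meaningful on the cells of the stated dimension, and
  \<open>mcomp M i j a b\<close> only when \<open>composable M i j a b\<close> holds; values elsewhere are irrelevant.
  \<open>gdom X i\<close> and \<open>gcod X i\<close> go from (\<open>i+1\<close>)-cells to \<open>i\<close>-cells, \<open>ident X i\<close> goes from
  \<open>i\<close>-cells to (\<open>i+1\<close>)-cells, and \<open>mcomp M i j\<close> composes \<open>j\<close>-cells along \<open>i\<close>-cells, in
  diagrammatic order.
\<close>

record 'a globular_set =
  cells :: "nat \<Rightarrow> 'a set"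
  gdom :: "nat \<Rightarrow> 'a \<Rightarrow> 'a"
  gcod :: "nat \<Rightarrow> 'a \<Rightarrow> 'a"

record 'a omega_graph = "'a globular_set" +
  ident :: "nat \<Rightarrow> 'a \<Rightarrow> 'a"

record 'a omega_magma = "'a omega_graph" +
  mcomp :: "nat \<Rightarrow> nat \<Rightarrow> 'a \<Rightarrow> 'a \<Rightarrow> 'a"

text \<open>
  \<open>itdom X i j\<close> and \<open>itcod X i j\<close> are the iterated maps from \<open>j\<close>-cells to \<open>i\<close>-cells and
  \<open>itid X i j\<close> is the iterated identity from \<open>i\<close>-cells to \<open>j\<close>-cells, for \<open>i \<le> j\<close>
  (the identity map for \<open>i = j\<close>).
\<close>

primrec itdom :: "('a, 'z) globular_set_scheme \<Rightarrow> nat \<Rightarrow> nat \<Rightarrow> 'a \<Rightarrow> 'a" where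
  "itdom X i 0 a = a"
| "itdom X i (Suc j) a = (if i \<le> j then itdom X i j (gdom X j a) else a)"

primrec itcod :: "('a, 'z) globular_set_scheme \<Rightarrow> nat \<Rightarrow> nat \<Rightarrow> 'a \<Rightarrow> 'a" where
  "itcod X i 0 a = a"
| "itcod X i (Suc j) a = (if i \<le> j then itcod X i j (gcod X j a) else a)"

primrec itid :: "('a, 'z) omega_graph_scheme \<Rightarrow> nat \<Rightarrow> nat \<Rightarrow> 'a \<Rightarrow> 'a" where
  "itid X i 0 a = a"
| "itid X i (Suc j) a = (if i \<le> j then ident X j (itid X i j a) else a)"

locale globular_set =
  fixes X :: "('a, 'z) globular_set_scheme"
  assumes gdom_closed: "a \<in> cells X (Suc i) \<Longrightarrow> gdom X i a \<in> cells X i"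
    and gcod_closed: "a \<in> cells X (Suc i) \<Longrightarrow> gcod X i a \<in> cells X i"
    and gdom_glob: "a \<in> cells X (Suc (Suc i)) \<Longrightarrow>
      gdom X i (gdom X (Suc i) a) = gdom X i (gcod X (Suc i) a)"
    and gcod_glob: "a \<in> cells X (Suc (Suc i)) \<Longrightarrow>
      gcod X i (gdom X (Suc i) a) = gcod X i (gcod X (Suc i) a)"

locale omega_graph = globular_set X for X :: "('a, 'z) omega_graph_scheme" +
  assumes ident_closed: "a \<in> cells X i \<Longrightarrow> ident X i a \<in> cells X (Suc i)"
    and gdom_ident: "a \<in> cells X i \<Longrightarrow> gdom X i (ident X i a) = a"
    and gcod_ident: "a \<in> cells X i \<Longrightarrow> gcod X i (ident X i a) = a"

definition composable :: "('a, 'z) globular_set_scheme \<Rightarrow> nat \<Rightarrow> nat \<Rightarrow> 'a \<Rightarrow> 'a \<Rightarrow> bool" where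
  "composable X i j a b \<longleftrightarrow>
    i < j \<and> a \<in> cells X j \<and> b \<in> cells X j \<and> itcod X i j a = itdom X i j b"

locale omega_magma = omega_graph X for X :: "('a, 'z) omega_magma_scheme" +
  assumes mcomp_closed: "composable X i j a b \<Longrightarrow> mcomp X i j a b \<in> cells X j"
    and gdom_mcomp: "composable X i (Suc i) a b \<Longrightarrow> gdom X i (mcomp X i (Suc i) a b) = gdom X i a"
    and gcod_mcomp: "composable X i (Suc i) a b \<Longrightarrow> gcod X i (mcomp X i (Suc i) a b) = gcod X i b"
    and gdom_mcomp_less: "\<lbrakk>composable X i (Suc j) a b; i < j\<rbrakk> \<Longrightarrow>
      gdom X j (mcomp X i (Suc j) a b) = mcomp X i j (gdom X j a) (gdom X j b)"
    and gcod_mcomp_less: "\<lbrakk>composable X i (Suc j) a b; i < j\<rbrakk> \<Longrightarrow>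
      gcod X j (mcomp X i (Suc j) a b) = mcomp X i j (gcod X j a) (gcod X j b)"

locale strict_omega_category = omega_magma X for X :: "('a, 'z) omega_magma_scheme" +
  assumes mcomp_assoc:
    "\<lbrakk>composable X i j a b; composable X i j (mcomp X i j a b) c;
      composable X i j b c; composable X i j a (mcomp X i j b c)\<rbrakk> \<Longrightarrow>
      mcomp X i j (mcomp X i j a b) c = mcomp X i j a (mcomp X i j b c)"
    and mcomp_interchange:
    "\<lbrakk>i < j; j < k;
      composable X j k a b; composable X j k c d;
      composable X i k (mcomp X j k a b) (mcomp X j k c d);
      composable X i k a c; composable X i k b d;
      composable X j k (mcomp X i k a c) (mcomp X i k b d)\<rbrakk> \<Longrightarrow>
      mcomp X i k (mcomp X j k a b) (mcomp X j k c d) =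
      mcomp X j k (mcomp X i k a c) (mcomp X i k b d)"
    and mcomp_unit_left: "\<lbrakk>i < j; a \<in> cells X j\<rbrakk> \<Longrightarrow>
      mcomp X i j (itid X i j (itdom X i j a)) a = a"
    and mcomp_unit_right: "\<lbrakk>i < j; a \<in> cells X j\<rbrakk> \<Longrightarrow>
      mcomp X i j a (itid X i j (itcod X i j a)) = a"
    and mcomp_ident: "composable X i j a b \<Longrightarrow>
      mcomp X i (Suc j) (ident X j a) (ident X j b) = ident X j (mcomp X i j a b)"


section \<open>Morphisms\<close>

text \<open>
  Morphisms are graded functions that are extensional, i.e. \<open>undefined\<close> outside the cells of the
  source, so that equality of morphisms is equality on cells.
\<close>

definition globular_hom ::
  "('a, 'y) globular_set_scheme \<Rightarrow> ('b, 'z) globular_set_scheme \<Rightarrow> (nat \<Rightarrow> 'a \<Rightarrow> 'b) set" where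
  "globular_hom X Y = {F.
    (\<forall>i. F i \<in> cells X i \<rightarrow>\<^sub>E cells Y i) \<and>
    (\<forall>i. \<forall>a\<in>cells X (Suc i). F i (gdom X i a) = gdom Y i (F (Suc i) a)) \<and>
    (\<forall>i. \<forall>a\<in>cells X (Suc i). F i (gcod X i a) = gcod Y i (F (Suc i) a))}"

definition omega_graph_hom ::
  "('a, 'y) omega_graph_scheme \<Rightarrow> ('b, 'z) omega_graph_scheme \<Rightarrow> (nat \<Rightarrow> 'a \<Rightarrow> 'b) set" where
  "omega_graph_hom X Y = {F \<in> globular_hom X Y.
    \<forall>i. \<forall>a\<in>cells X i. F (Suc i) (ident X i a) = ident Y i (F i a)}"

definition omega_magma_hom ::
  "('a, 'y) omega_magma_scheme \<Rightarrow> ('b, 'z) omega_magma_scheme \<Rightarrow> (nat \<Rightarrow> 'a \<Rightarrow> 'b) set" where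
  "omega_magma_hom X Y = {F \<in> omega_graph_hom X Y.
    \<forall>i j a b. composable X i j a b \<longrightarrow> F j (mcomp X i j a b) = mcomp Y i j (F j a) (F j b)}"

definition gid :: "('a, 'z) globular_set_scheme \<Rightarrow> nat \<Rightarrow> 'a \<Rightarrow> 'a" where
  "gid X = (\<lambda>i. \<lambda>a\<in>cells X i. a)"

definition gcompose ::
  "('a, 'z) globular_set_scheme \<Rightarrow> (nat \<Rightarrow> 'b \<Rightarrow> 'c) \<Rightarrow> (nat \<Rightarrow> 'a \<Rightarrow> 'b) \<Rightarrow> nat \<Rightarrow> 'a \<Rightarrow> 'c" where
  "gcompose X G F = (\<lambda>i. compose (cells X i) (G i) (F i))"


section \<open>Bridge relations and weak omega categories\<close>

definition parallel :: "('a, 'z) globular_set_scheme \<Rightarrow> nat \<Rightarrow> 'a \<Rightarrow> 'a \<Rightarrow> bool" where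
  "parallel X i a b \<longleftrightarrow> a \<in> cells X i \<and> b \<in> cells X i \<and>
    (\<forall>k. i = Suc k \<longrightarrow> gdom X k a = gdom X k b \<and> gcod X k a = gcod X k b)"

type_synonym 'a bridge = "nat \<Rightarrow> ('a \<times> 'a \<times> 'a) set"

definition bridge_relation :: "('a, 'z) omega_graph_scheme \<Rightarrow> 'a bridge \<Rightarrow> bool" where
  "bridge_relation X R \<longleftrightarrow>
    (\<forall>i. R i \<subseteq> cells X i \<times> cells X i \<times> cells X (Suc i)) \<and>
    (\<forall>i a b c. (a, b, c) \<in> R i \<longrightarrow> parallel X i a b \<and> gdom X i c = a \<and> gcod X i c = b) \<and>
    (\<forall>i. \<forall>a\<in>cells X i. (a, a, ident X i a) \<in> R i) \<and>
    (\<forall>i a b c d. (a, b, c) \<in> R i \<and> (a, b, d) \<in> R i \<longrightarrow> c = d)"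

definition diagonal_bridge :: "('a, 'z) omega_graph_scheme \<Rightarrow> 'a bridge" where
  "diagonal_bridge X i = {(a, a, ident X i a) | a. a \<in> cells X i}"

definition bridge_hom ::
  "('a, 'y) omega_magma_scheme \<Rightarrow> 'a bridge \<Rightarrow> ('b, 'z) omega_magma_scheme \<Rightarrow> 'b bridge \<Rightarrow>
    (nat \<Rightarrow> 'a \<Rightarrow> 'b) set" where
  "bridge_hom X R Y R' = {F \<in> omega_magma_hom X Y.
    \<forall>i a b c. (a, b, c) \<in> R i \<longrightarrow> (F i a, F i b, F (Suc i) c) \<in> R' i}"

definition categorical_Penon_morphism ::
  "('a, 'y) omega_magma_scheme \<Rightarrow> 'a bridge \<Rightarrow> ('b, 'z) omega_magma_scheme \<Rightarrow> 'b bridge \<Rightarrow>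
    (nat \<Rightarrow> 'a \<Rightarrow> 'b) \<Rightarrow> bool" where
  "categorical_Penon_morphism X R Y R' F \<longleftrightarrow>
    F \<in> bridge_hom X R Y R' \<and> strict_omega_category Y \<and> R' = diagonal_bridge Y \<and>
    (\<forall>i a b c. (a, b, c) \<in> R i \<longrightarrow> F i a = F i b \<and> F (Suc i) c = ident Y i (F i a)) \<and>
    (\<forall>i a b. parallel X i a b \<and> F i a = F i b \<longrightarrow> (\<exists>c. (a, b, c) \<in> R i))"

record ('a, 'b, 'c) weak_omega_category =
  mag1 :: "'a omega_magma"
  mag2 :: "'b omega_magma"
  mag3 :: "'c omega_magma"
  lam :: "nat \<Rightarrow> 'b \<Rightarrow> 'a"
  rho :: "nat \<Rightarrow> 'a \<Rightarrow> 'b"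
  brel :: "'b bridge"
  kap :: "nat \<Rightarrow> 'b \<Rightarrow> 'c"

locale weak_omega_category =
  fixes X :: "('a, 'b, 'c) weak_omega_category"
  assumes mag1: "omega_magma (mag1 X)"
    and mag2: "omega_magma (mag2 X)"
    and mag3: "strict_omega_category (mag3 X)"
    and lam: "lam X \<in> omega_magma_hom (mag2 X) (mag1 X)"
    and rho: "rho X \<in> omega_graph_hom (mag1 X) (mag2 X)"
    and lam_rho: "gcompose (mag1 X) (lam X) (rho X) = gid (mag1 X)"
    and brel: "bridge_relation (mag2 X) (brel X)"
    and kap: "categorical_Penon_morphism
      (mag2 X) (brel X) (mag3 X) (diagonal_bridge (mag3 X)) (kap X)"


section \<open>Omega pseudo-functors\<close>

type_synonym ('a, 'b, 'c, 'd, 'e, 'f) omega_maps =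
  "(nat \<Rightarrow> 'a \<Rightarrow> 'd) \<times> (nat \<Rightarrow> 'b \<Rightarrow> 'e) \<times> (nat \<Rightarrow> 'c \<Rightarrow> 'f)"

definition omega_pseudo_functor ::
  "('a, 'b, 'c) weak_omega_category \<Rightarrow> ('d, 'e, 'f) weak_omega_category \<Rightarrow>
    ('a, 'b, 'c, 'd, 'e, 'f) omega_maps \<Rightarrow> bool" where
  "omega_pseudo_functor X Y = (\<lambda>(F1, F2, F3).
    F1 \<in> globular_hom (mag1 X) (mag1 Y) \<and>
    F2 \<in> globular_hom (mag2 X) (mag2 Y) \<and>
    F3 \<in> globular_hom (mag3 X) (mag3 Y) \<and>
    F3 \<in> omega_graph_hom (mag3 X) (mag3 Y) \<and>
    gcompose (mag2 X) F1 (lam X) = gcompose (mag2 X) (lam Y) F2 \<and>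
    gcompose (mag2 X) F3 (kap X) = gcompose (mag2 X) (kap Y) F2 \<and>
    (\<forall>j a b. composable (mag2 X) j (Suc j) a b \<longrightarrow>
      kap Y (Suc j) (mcomp (mag2 Y) j (Suc j) (F2 (Suc j) a) (F2 (Suc j) b)) =
      kap Y (Suc j) (F2 (Suc j) (mcomp (mag2 X) j (Suc j) a b))))"


section \<open>The free omega clique on two points\<close>

locale omega_clique = omega_magma M for M :: "('a, 'z) omega_magma_scheme" +
  fixes R :: "'a bridge"
  assumes clique_bridge: "bridge_relation M R"
    and clique_total: "parallel M i a b \<Longrightarrow> \<exists>c. (a, b, c) \<in> R i"

datatype two = One | Two

text \<open>
  \<open>K(2)\<close>: the \<open>i\<close>-cells are, for each of the two points, the \<open>i\<close>-fold iterated identity on it.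
\<close>

definition K2 :: "two omega_graph" where
  "K2 = \<lparr>cells = (\<lambda>_. UNIV), gdom = (\<lambda>_ a. a), gcod = (\<lambda>_ a. a), ident = (\<lambda>_ a. a)\<rparr>"

text \<open>
  \<open>Cl(2)\<close> is realised by well-formed terms. Since a bridge relation contains \<open>(a, a, id a)\<close> and is
  single-valued, the identity on \<open>a\<close> has to be the bridge cell \<open>Bridge a a\<close>. Beyond this the axioms
  of an omega clique impose no equations between cells, so no quotient is needed; the universal
  property is established in \<open>Cl2_universal\<close> below.
\<close>

datatype cl2 = Point two | Bridge cl2 cl2 | Comp nat cl2 cl2

primrec tdim :: "cl2 \<Rightarrow> nat" where
  "tdim (Point p) = 0"
| "tdim (Bridge a b) = Suc (tdim a)"
| "tdim (Comp i a b) = tdim a"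

primrec tdom :: "cl2 \<Rightarrow> cl2" where
  "tdom (Point p) = Point p"
| "tdom (Bridge a b) = a"
| "tdom (Comp i a b) = (if Suc i = tdim a then tdom a else Comp i (tdom a) (tdom b))"

primrec tcod :: "cl2 \<Rightarrow> cl2" where
  "tcod (Point p) = Point p"
| "tcod (Bridge a b) = b"
| "tcod (Comp i a b) = (if Suc i = tdim a then tcod b else Comp i (tcod a) (tcod b))"

primrec wf_term :: "cl2 \<Rightarrow> bool" where
  "wf_term (Point p) \<longleftrightarrow> True"
| "wf_term (Bridge a b) \<longleftrightarrow> wf_term a \<and> wf_term b \<and> tdim a = tdim b \<and>
    (tdim a > 0 \<longrightarrow> tdom a = tdom b \<and> tcod a = tcod b)"
| "wf_term (Comp i a b) \<longleftrightarrow> wf_term a \<and> wf_term b \<and> tdim a = tdim b \<and> i < tdim a \<and>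
    (tcod ^^ (tdim a - i)) a = (tdom ^^ (tdim a - i)) b"

definition Cl2 :: "cl2 omega_magma" where
  "Cl2 = \<lparr>cells = (\<lambda>n. {t. wf_term t \<and> tdim t = n}), gdom = (\<lambda>_. tdom), gcod = (\<lambda>_. tcod),
    ident = (\<lambda>_ a. Bridge a a), mcomp = (\<lambda>i _. Comp i)\<rparr>"

definition Cl2_bridge :: "cl2 bridge" where
  "Cl2_bridge n = {(a, b, Bridge a b) | a b. parallel Cl2 n a b}"

definition K2_to_Cl2 :: "nat \<Rightarrow> two \<Rightarrow> cl2" where
  "K2_to_Cl2 n p = itid Cl2 0 n (Point p)"

text \<open>The bridge 1-cells \<open>c(i,j)\<close>.\<close>

definition cl2_arrow :: "two \<Rightarrow> two \<Rightarrow> cl2" where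
  "cl2_arrow p q = Bridge (Point p) (Point q)"

lemma wf_term_boundary:
  assumes "wf_term t" "tdim t = Suc n"
  shows "wf_term (tdom t) \<and> wf_term (tcod t) \<and> tdim (tdom t) = n \<and> tdim (tcod t) = n \<and>
    (n > 0 \<longrightarrow> tdom (tdom t) = tdom (tcod t) \<and> tcod (tdom t) = tcod (tcod t))"
  using assms
proof (induction t arbitrary: n)
  case (Point p)
  then show ?case by simp
next
  case (Bridge a b)
  then show ?case by auto
next
  case (Comp i a b)
  have a: "wf_term a" "tdim a = Suc n" and b: "wf_term b" "tdim b = Suc n"
    and i: "i \<le> n" and glue: "(tcod ^^ (Suc n - i)) a = (tdom ^^ (Suc n - i)) b"
    using Comp.prems by auto
  note A = Comp.IH(1)[OF a] and B = Comp.IH(2)[OF b]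
  show ?case
  proof (cases "i = n")
    case True
    then have "tcod a = tdom b" using glue by simp
    then show ?thesis using A B True a b by auto
  next
    case False
    define k where "k = n - Suc i"
    have nk: "n - i = Suc k" "Suc n - i = Suc (Suc k)" using False i unfolding k_def by auto
    have n: "n > 0" using False i by simp
    have ab: "tcod (tdom a) = tcod (tcod a)" "tdom (tdom b) = tdom (tcod b)"
      using A B n by auto
    have glue': "(tcod ^^ k) (tcod (tcod a)) = (tdom ^^ k) (tdom (tdom b))"
      using glue unfolding nk by (simp add: funpow_swap1)
    have "(tcod ^^ (n - i)) (tdom a) = (tdom ^^ (n - i)) (tdom b)"
      "(tcod ^^ (n - i)) (tcod a) = (tdom ^^ (n - i)) (tcod b)"
      using glue' ab unfolding nk by (simp_all add: funpow_swap1)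
    then show ?thesis using A B a b False i n by auto
  qed
qed

lemma Cl2_simps [simp]:
  "t \<in> cells Cl2 n \<longleftrightarrow> wf_term t \<and> tdim t = n"
  "gdom Cl2 n = tdom" "gcod Cl2 n = tcod" "ident Cl2 n a = Bridge a a" "mcomp Cl2 i j = Comp i"
  by (auto simp: Cl2_def)

lemma itdom_Cl2: "i \<le> j \<Longrightarrow> itdom Cl2 i j t = (tdom ^^ (j - i)) t"
proof (induction j arbitrary: t)
  case (Suc j)
  then show ?case by (cases "i = Suc j") (auto simp: Suc_diff_le funpow_swap1)
qed simp

lemma itcod_Cl2: "i \<le> j \<Longrightarrow> itcod Cl2 i j t = (tcod ^^ (j - i)) t"
proof (induction j arbitrary: t)
  case (Suc j)
  then show ?case by (cases "i = Suc j") (auto simp: Suc_diff_le funpow_swap1)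
qed simp

lemma composable_Cl2:
  "composable Cl2 i j a b \<longleftrightarrow> wf_term (Comp i a b) \<and> tdim (Comp i a b) = j"
  by (auto simp: composable_def itdom_Cl2 itcod_Cl2)

lemma parallel_Cl2:
  "parallel Cl2 i a b \<longleftrightarrow> wf_term (Bridge a b) \<and> tdim a = i"
  by (auto simp: parallel_def gr0_conv_Suc)

lemma Cl2_omega_clique: "omega_clique Cl2 Cl2_bridge"
proof unfold_locales
  fix a i assume "a \<in> cells Cl2 (Suc i)"
  then show "gdom Cl2 i a \<in> cells Cl2 i" "gcod Cl2 i a \<in> cells Cl2 i"
    using wf_term_boundary[of a i] by auto
next
  fix a i assume "a \<in> cells Cl2 (Suc (Suc i))"
  then show "gdom Cl2 i (gdom Cl2 (Suc i) a) = gdom Cl2 i (gcod Cl2 (Suc i) a)"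
    "gcod Cl2 i (gdom Cl2 (Suc i) a) = gcod Cl2 i (gcod Cl2 (Suc i) a)"
    using wf_term_boundary[of a "Suc i"] by auto
qed (auto simp: composable_Cl2 parallel_Cl2 bridge_relation_def Cl2_bridge_def)

lemma K2_to_Cl2_hom: "K2_to_Cl2 \<in> omega_graph_hom K2 Cl2"
proof -
  have "wf_term (K2_to_Cl2 n p) \<and> tdim (K2_to_Cl2 n p) = n" for n p
    by (induction n) (auto simp: K2_to_Cl2_def)
  then show ?thesis
    by (auto simp: omega_graph_hom_def globular_hom_def K2_def K2_to_Cl2_def)
qed

text \<open>The extension of a map of the two points to the terms.\<close>

context
  fixes M :: "('a, 'z) omega_magma_scheme" and R :: "'a bridge" and x :: "two \<Rightarrow> 'a"
begin

primrec cl2_eval :: "cl2 \<Rightarrow> 'a" where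
  "cl2_eval (Point p) = x p"
| "cl2_eval (Bridge a b) = (THE c. (cl2_eval a, cl2_eval b, c) \<in> R (tdim a))"
| "cl2_eval (Comp i a b) = mcomp M i (tdim a) (cl2_eval a) (cl2_eval b)"

end

context omega_clique
begin

lemma bridge_THE:
  assumes "parallel M n a b"
  shows "(a, b, THE c. (a, b, c) \<in> R n) \<in> R n"
proof -
  obtain c where "(a, b, c) \<in> R n" using clique_total assms by blast
  moreover have "d = c" if "(a, b, d) \<in> R n" for d
    using that clique_bridge \<open>(a, b, c) \<in> R n\<close> unfolding bridge_relation_def by blast
  ultimately show ?thesis by (rule theI)
qed

lemma bridge_boundary:
  assumes "(a, b, c) \<in> R n"
  shows "parallel M n a b" "c \<in> cells M (Suc n)" "gdom M n c = a" "gcod M n c = b"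
  using assms clique_bridge unfolding bridge_relation_def by blast+

lemma bridge_unique: "(a, b, c) \<in> R n \<Longrightarrow> (a, b, d) \<in> R n \<Longrightarrow> c = d"
  using clique_bridge unfolding bridge_relation_def by blast

lemma cl2_eval_boundary:
  fixes x :: "two \<Rightarrow> 'a"
  assumes x: "\<And>p. x p \<in> cells M 0"
  defines "e \<equiv> cl2_eval M R x"
  shows "wf_term t \<Longrightarrow> tdim t = n \<Longrightarrow> e t \<in> cells M n \<and>
    (\<forall>m. n = Suc m \<longrightarrow> gdom M m (e t) = e (tdom t) \<and> gcod M m (e t) = e (tcod t))"
proof (induction n arbitrary: t rule: less_induct)
  case (less n)
  note outer = less.IH
  have it: "itdom M i m (e s) = e ((tdom ^^ (m - i)) s) \<and>
      itcod M i m (e s) = e ((tcod ^^ (m - i)) s)"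
    if "i \<le> m" "m < n" "wf_term s" "tdim s = m" for i m s
    using that
  proof (induction m arbitrary: s)
    case 0
    then show ?case by simp
  next
    case (Suc m)
    show ?case
    proof (cases "i = Suc m")
      case False
      then have "i \<le> m" using Suc.prems by simp
      moreover have "gdom M m (e s) = e (tdom s)" "gcod M m (e s) = e (tcod s)"
        using outer[of "Suc m" s] Suc.prems by auto
      moreover have "wf_term (tdom s)" "wf_term (tcod s)" "tdim (tdom s) = m" "tdim (tcod s) = m"
        using wf_term_boundary[of s m] Suc.prems by auto
      ultimately show ?thesis
        using Suc.IH[of "tdom s"] Suc.IH[of "tcod s"] Suc.prems
        by (simp add: Suc_diff_le funpow_swap1)
    qed simp
  qed
  show ?case using less.prems
  proof (induction t)
    case (Point p)
    then show ?case using x by (auto simp: e_def)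
  next
    case (Bridge a b)
    define m where "m = tdim a"
    have n: "n = Suc m" and wf: "wf_term a" "wf_term b" "tdim a = m" "tdim b = m"
      and par: "m > 0 \<longrightarrow> tdom a = tdom b \<and> tcod a = tcod b"
      using Bridge.prems m_def by auto
    have "parallel M m (e a) (e b)"
      using outer[of m a] outer[of m b] wf n par by (auto simp: parallel_def)
    from bridge_THE[OF this] have "(e a, e b, e (Bridge a b)) \<in> R m"
      by (simp add: e_def m_def)
    then show ?case using bridge_boundary n by auto
  next
    case (Comp i a b)
    have wf: "wf_term a" "wf_term b" "tdim a = n" "tdim b = n" and i: "i < n"
      and glue: "(tcod ^^ (n - i)) a = (tdom ^^ (n - i)) b"
      using Comp.prems by auto
    note A = Comp.IH(1)[OF wf(1,3)] and B = Comp.IH(2)[OF wf(2,4)]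
    obtain m where n: "n = Suc m" using i by (cases n) auto
    have bd: "wf_term (tdom b)" "tdim (tdom b) = m" "wf_term (tcod a)" "tdim (tcod a) = m"
      "tdim (tdom a) = m"
      using wf_term_boundary[of a m] wf_term_boundary[of b m] wf n by auto
    have A': "e a \<in> cells M n" "gdom M m (e a) = e (tdom a)" "gcod M m (e a) = e (tcod a)"
      and B': "e b \<in> cells M n" "gdom M m (e b) = e (tdom b)" "gcod M m (e b) = e (tcod b)"
      using A B n by blast+
    have "i \<le> m" "m < n" using i n by simp_all
    then have "itcod M i n (e a) = e ((tcod ^^ (n - i)) a)"
      "itdom M i n (e b) = e ((tdom ^^ (n - i)) b)"
      using it[OF _ _ bd(3,4)] it[OF _ _ bd(1,2)] A' B'
      by (simp_all add: n Suc_diff_le funpow_swap1)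
    then have comp: "composable M i n (e a) (e b)"
      using A'(1) B'(1) i glue by (simp add: composable_def)
    have e: "e (Comp i a b) = mcomp M i n (e a) (e b)"
      using wf by (simp add: e_def)
    show ?case
    proof (cases "i = m")
      case True
      then show ?thesis unfolding e
        using comp n wf(3) A' B' gdom_mcomp[of i "e a" "e b"] gcod_mcomp[of i "e a" "e b"]
          mcomp_closed[OF comp]
        by simp
    next
      case False
      then have im: "i < m" using i n by simp
      have "e (Comp i (tdom a) (tdom b)) = mcomp M i m (e (tdom a)) (e (tdom b))"
        "e (Comp i (tcod a) (tcod b)) = mcomp M i m (e (tcod a)) (e (tcod b))"
        using bd by (simp_all add: e_def)
      then show ?thesis unfolding e
        using comp n wf(3) A' B' im gdom_mcomp_less[of i m "e a" "e b"]
          gcod_mcomp_less[of i m "e a" "e b"] mcomp_closed[OF comp]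
        by simp
    qed
  qed
qed

theorem Cl2_universal:
  assumes f: "f \<in> omega_graph_hom K2 M"
  shows "\<exists>!H. H \<in> bridge_hom Cl2 Cl2_bridge M R \<and> gcompose K2 H K2_to_Cl2 = f"
proof -
  define e where "e = cl2_eval M R (f 0)"
  have f0: "f 0 p \<in> cells M 0" for p
  proof -
    have "f 0 \<in> cells K2 0 \<rightarrow>\<^sub>E cells M 0"
      using f unfolding omega_graph_hom_def globular_hom_def by blast
    then show ?thesis by (auto simp: K2_def)
  qed
  have f_Suc: "f (Suc n) p = ident M n (f n p)" for n p
  proof -
    have "\<forall>a\<in>cells K2 n. f (Suc n) (ident K2 n a) = ident M n (f n a)"
      using f unfolding omega_graph_hom_def by blast
    then show ?thesis by (simp add: K2_def)
  qed
  have e_cell: "e t \<in> cells M n" if "wf_term t" "tdim t = n" for t n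
    using cl2_eval_boundary[of "f 0" t n] f0 that by (simp add: e_def)
  have e_bd: "gdom M n (e t) = e (tdom t)" "gcod M n (e t) = e (tcod t)"
    if "wf_term t" "tdim t = Suc n" for t n
    using cl2_eval_boundary[of "f 0" t "Suc n"] f0 that by (simp_all add: e_def)
  have e_bridge: "(e a, e b, e (Bridge a b)) \<in> R n" if "wf_term (Bridge a b)" "tdim a = n" for a b n
  proof -
    have "parallel M n (e a) (e b)"
      using that e_cell e_bd by (auto simp: parallel_def)
    from bridge_THE[OF this] show ?thesis using that by (simp add: e_def)
  qed
  have e_ident: "e (Bridge a a) = ident M n (e a)" if "wf_term a" "tdim a = n" for a n
  proof (rule bridge_unique)
    show "(e a, e a, e (Bridge a a)) \<in> R n" using e_bridge[of a a n] that by simp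
    show "(e a, e a, ident M n (e a)) \<in> R n"
      using e_cell[OF that] clique_bridge unfolding bridge_relation_def by blast
  qed
  define H where "H = (\<lambda>n. \<lambda>t\<in>cells Cl2 n. e t)"
  have H: "H n t = e t" if "wf_term t" "tdim t = n" for n t
    using that by (simp add: H_def)
  have H_cell: "H i \<in> cells Cl2 i \<rightarrow>\<^sub>E cells M i" for i
    unfolding H_def restrict_PiE_iff using e_cell by simp
  have H_bd: "H i (tdom a) = gdom M i (H (Suc i) a)" "H i (tcod a) = gcod M i (H (Suc i) a)"
    if "wf_term a" "tdim a = Suc i" for a i
    using e_bd[OF that] wf_term_boundary[OF that] H that by simp_all
  have "H \<in> globular_hom Cl2 M"
    unfolding globular_hom_def using H_cell H_bd by simp
  moreover have "H (Suc i) (Bridge a a) = ident M i (H i a)" if "wf_term a" "tdim a = i" for a i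
    using e_ident[OF that] H that by simp
  moreover have "H j (Comp i a b) = mcomp M i j (H j a) (H j b)"
    if "wf_term (Comp i a b)" "tdim (Comp i a b) = j" for i j a b
  proof -
    have "e (Comp i a b) = mcomp M i j (e a) (e b)" using that by (simp add: e_def)
    then show ?thesis using H[OF that] H[of a j] H[of b j] that by simp
  qed
  moreover have "(H i a, H i b, H (Suc i) c) \<in> R i" if "(a, b, c) \<in> Cl2_bridge i" for i a b c
  proof -
    have c: "c = Bridge a b" and wf: "wf_term (Bridge a b)" "tdim a = i"
      using that by (auto simp: Cl2_bridge_def parallel_Cl2)
    show ?thesis using e_bridge[OF wf] wf H[of a i] H[of b i] H[of c "Suc i"] unfolding c by simp
  qed
  ultimately have H_hom: "H \<in> bridge_hom Cl2 Cl2_bridge M R"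
    unfolding bridge_hom_def omega_magma_hom_def omega_graph_hom_def composable_Cl2
    by (simp del: tdim.simps wf_term.simps)
  have ext: "(gcompose K2 G K2_to_Cl2 = f) \<longleftrightarrow> (\<forall>p. G 0 (Point p) = f 0 p)"
    if G: "G \<in> bridge_hom Cl2 Cl2_bridge M R" for G
  proof
    assume "gcompose K2 G K2_to_Cl2 = f"
    then show "\<forall>p. G 0 (Point p) = f 0 p"
      by (auto simp: gcompose_def compose_def K2_def K2_to_Cl2_def)
  next
    assume *: "\<forall>p. G 0 (Point p) = f 0 p"
    have K: "K2_to_Cl2 n p \<in> cells Cl2 n" for n p
      by (induction n) (auto simp: K2_to_Cl2_def)
    have "G n (K2_to_Cl2 n p) = f n p" for n p
    proof (induction n)
      case 0
      then show ?case using * by (simp add: K2_to_Cl2_def)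
    next
      case (Suc n)
      have "G (Suc n) (ident Cl2 n (K2_to_Cl2 n p)) = ident M n (G n (K2_to_Cl2 n p))"
        using G K[of n p] unfolding bridge_hom_def omega_magma_hom_def omega_graph_hom_def by blast
      then show ?case using Suc by (simp add: f_Suc K2_to_Cl2_def)
    qed
    then show "gcompose K2 G K2_to_Cl2 = f"
      by (simp add: gcompose_def compose_def K2_def restrict_def)
  qed
  have unique: "G n t = e t"
    if G: "G \<in> bridge_hom Cl2 Cl2_bridge M R" and Gf: "gcompose K2 G K2_to_Cl2 = f"
      and t: "wf_term t" "tdim t = n" for G t n
    using t
  proof (induction t arbitrary: n)
    case (Point p)
    then show ?case using ext[OF G] Gf by (simp add: e_def)
  next
    case (Bridge a b)
    then have ab: "wf_term (Bridge a b)" "n = Suc (tdim a)" by simp_all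
    then have "(a, b, Bridge a b) \<in> Cl2_bridge (tdim a)"
      by (simp add: Cl2_bridge_def parallel_Cl2)
    then have "(G (tdim a) a, G (tdim a) b, G n (Bridge a b)) \<in> R (tdim a)"
      using G ab unfolding bridge_hom_def by blast
    moreover have "G (tdim a) a = e a" "G (tdim a) b = e b"
      using Bridge by auto
    ultimately show ?case using e_bridge[OF ab(1) refl] bridge_unique by metis
  next
    case (Comp i a b)
    then have "composable Cl2 i n a b" unfolding composable_Cl2 by blast
    then have "G n (mcomp Cl2 i n a b) = mcomp M i n (G n a) (G n b)"
      using G unfolding bridge_hom_def omega_magma_hom_def by blast
    moreover have "G n a = e a" "G n b = e b" "tdim a = n" using Comp by auto
    ultimately show ?case by (simp add: e_def)
  qed
  show ?thesis
  proof (rule ex1I[of _ H], intro conjI)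
    show "H \<in> bridge_hom Cl2 Cl2_bridge M R" by (fact H_hom)
    show "gcompose K2 H K2_to_Cl2 = f"
      unfolding ext[OF H_hom] by (simp add: H e_def)
  next
    fix G assume "G \<in> bridge_hom Cl2 Cl2_bridge M R \<and> gcompose K2 G K2_to_Cl2 = f"
    then have G: "G \<in> bridge_hom Cl2 Cl2_bridge M R" "gcompose K2 G K2_to_Cl2 = f" by auto
    have Gu: "G n \<in> extensional (cells Cl2 n)" for n
    proof -
      have "G n \<in> cells Cl2 n \<rightarrow>\<^sub>E cells M n"
        using G(1) unfolding bridge_hom_def omega_magma_hom_def omega_graph_hom_def globular_hom_def
        by blast
      then show ?thesis by (simp add: PiE_def)
    qed
    show "G = H"
    proof (rule HOL.ext, rule HOL.ext)
      fix n t
      show "G n t = H n t"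
      proof (cases "t \<in> cells Cl2 n")
        case True
        then show ?thesis using unique[OF G] H by simp
      next
        case False
        then show ?thesis
          using extensional_arb[OF Gu False] by (simp add: H_def del: Cl2_simps)
      qed
    qed
  qed
qed

end


section \<open>Internal equivalences\<close>

text \<open>
  \<open>hom_magma M n a b\<close> is \<open>M(a,b)\<close> for \<open>n\<close>-cells \<open>a\<close>, \<open>b\<close>, i.e. with \<open>i = n + 1\<close> in the usual
  indexing \<open>M(a,b)\<^sub>j \<subseteq> M\<^sub>i\<^sub>+\<^sub>j\<close>.
\<close>

definition hom_magma :: "('a, 'z) omega_magma_scheme \<Rightarrow> nat \<Rightarrow> 'a \<Rightarrow> 'a \<Rightarrow> 'a omega_magma" where
  "hom_magma M n a b =
    \<lparr>cells = (\<lambda>j. {c \<in> cells M (Suc n + j).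
       itdom M n (Suc n + j) c = a \<and> itcod M n (Suc n + j) c = b}),
     gdom = (\<lambda>j. gdom M (Suc n + j)), gcod = (\<lambda>j. gcod M (Suc n + j)),
     ident = (\<lambda>j. ident M (Suc n + j)),
     mcomp = (\<lambda>k j. mcomp M (Suc n + k) (Suc n + j))\<rparr>"

fun elementary_equivs :: "('a, 'z) omega_magma_scheme \<Rightarrow> nat \<Rightarrow> 'a set" where
  "elementary_equivs M 0 = {}"
| "elementary_equivs M (Suc 0) = {f \<in> cells M 1.
    f \<in> ident M 0 ` cells M 0 \<or>
    (\<exists>H \<in> omega_magma_hom Cl2 M. H 1 (cl2_arrow One Two) = f)}"
| "elementary_equivs M (Suc (Suc n)) = {f \<in> cells M (Suc (Suc n)).
    f \<in> ident M (Suc n) ` cells M (Suc n) \<or>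
    (\<exists>H \<in> omega_magma_hom Cl2
         (hom_magma M n (itdom M n (Suc (Suc n)) f) (itcod M n (Suc (Suc n)) f)).
       H 1 (cl2_arrow One Two) = f)}"

text \<open>
  The closure under composites, one dimension \<open>j\<close> at a time; all composites of \<open>j\<close>-cells are
  \<open>j\<close>-cells.
\<close>

inductive_set comp_closure ::
  "('a, 'z) omega_magma_scheme \<Rightarrow> (nat \<Rightarrow> 'a set) \<Rightarrow> nat \<Rightarrow> 'a set"
  for M :: "('a, 'z) omega_magma_scheme" and S :: "nat \<Rightarrow> 'a set" and j :: nat where
  base: "a \<in> S j \<Longrightarrow> a \<in> comp_closure M S j"
| step: "\<lbrakk>a \<in> comp_closure M S j; b \<in> comp_closure M S j; composable M i j a b\<rbrakk> \<Longrightarrow>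
    mcomp M i j a b \<in> comp_closure M S j"

fun inv_cells :: "('a, 'z) omega_magma_scheme \<Rightarrow> (nat \<Rightarrow> 'a set) \<Rightarrow> nat \<Rightarrow> 'a set" where
  "inv_cells M S 0 = {}"
| "inv_cells M S (Suc n) = {f \<in> cells M (Suc n). \<exists>g \<in> cells M (Suc n).
    gdom M n g = gcod M n f \<and> gcod M n g = gdom M n f \<and>
    (\<exists>h \<in> S (Suc (Suc n)). \<exists>h' \<in> S (Suc (Suc n)).
      gdom M (Suc n) h = mcomp M n (Suc n) f g \<and>
      gcod M (Suc n) h = ident M n (gdom M n f) \<and>
      gdom M (Suc n) h' = mcomp M n (Suc n) g f \<and>
      gcod M (Suc n) h' = ident M n (gcod M n f))}"

text \<open>The stage \<open>S\<^sub>i\<close> of the construction is \<open>equiv_stage M (i - 1)\<close>, for \<open>i \<ge> 1\<close>.\<close>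

primrec equiv_stage :: "('a, 'z) omega_magma_scheme \<Rightarrow> nat \<Rightarrow> nat \<Rightarrow> 'a set" where
  "equiv_stage M 0 = comp_closure M (elementary_equivs M)"
| "equiv_stage M (Suc i) =
    comp_closure M (\<lambda>k. equiv_stage M i k \<union> inv_cells M (equiv_stage M i) k)"

definition internal_equivs :: "('a, 'z) omega_magma_scheme \<Rightarrow> nat \<Rightarrow> 'a set" where
  "internal_equivs M k = (\<Union>i. equiv_stage M i k)"

definition equivalent_cells ::
  "('a, 'b, 'c) weak_omega_category \<Rightarrow> nat \<Rightarrow> ('a \<times> 'a) set" where
  "equivalent_cells X i = {(a, b). a \<in> cells (mag1 X) i \<and> b \<in> cells (mag1 X) i \<and>
    (\<exists>f \<in> internal_equivs (mag1 X) (Suc i). gdom (mag1 X) i f = a \<and> gcod (mag1 X) i f = b)}"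

definition tame ::
  "('a, 'b, 'c) weak_omega_category \<Rightarrow> ('d, 'e, 'f) weak_omega_category \<Rightarrow>
    ('a, 'b, 'c, 'd, 'e, 'f) omega_maps \<Rightarrow> bool" where
  "tame X Y = (\<lambda>(F1, F2, F3).
    \<forall>k. F1 k ` internal_equivs (mag1 X) k \<subseteq> internal_equivs (mag1 Y) k)"


section \<open>Categories and functors\<close>

text \<open>
  Categories are given by hom-sets; a morphism does not determine its source and target, so
  composition and the arrow part of a functor take the objects as arguments.
  \<open>Cmp C x y z g f\<close> is the composite of \<open>f : x \<rightarrow> y\<close> followed by \<open>g : y \<rightarrow> z\<close>.
\<close>

record ('o, 'm) category =
  Ob :: "'o set"
  Hom :: "'o \<Rightarrow> 'o \<Rightarrow> 'm set"
  Idn :: "'o \<Rightarrow> 'm"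
  Cmp :: "'o \<Rightarrow> 'o \<Rightarrow> 'o \<Rightarrow> 'm \<Rightarrow> 'm \<Rightarrow> 'm"

locale category =
  fixes C :: "('o, 'm) category"
  assumes Idn_in_Hom: "x \<in> Ob C \<Longrightarrow> Idn C x \<in> Hom C x x"
    and Cmp_in_Hom: "\<lbrakk>x \<in> Ob C; y \<in> Ob C; z \<in> Ob C; f \<in> Hom C x y; g \<in> Hom C y z\<rbrakk> \<Longrightarrow>
      Cmp C x y z g f \<in> Hom C x z"
    and Cmp_Idn_left: "\<lbrakk>x \<in> Ob C; y \<in> Ob C; f \<in> Hom C x y\<rbrakk> \<Longrightarrow> Cmp C x y y (Idn C y) f = f"
    and Cmp_Idn_right: "\<lbrakk>x \<in> Ob C; y \<in> Ob C; f \<in> Hom C x y\<rbrakk> \<Longrightarrow> Cmp C x x y f (Idn C x) = f"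
    and Cmp_assoc: "\<lbrakk>w \<in> Ob C; x \<in> Ob C; y \<in> Ob C; z \<in> Ob C;
      f \<in> Hom C w x; g \<in> Hom C x y; h \<in> Hom C y z\<rbrakk> \<Longrightarrow>
      Cmp C w x z (Cmp C x y z h g) f = Cmp C w y z h (Cmp C w x y g f)"

locale category_functor = source: category C + target: category D
  for C :: "('o, 'm) category" and D :: "('p, 'n) category" +
  fixes Fo :: "'o \<Rightarrow> 'p" and Fm :: "'o \<Rightarrow> 'o \<Rightarrow> 'm \<Rightarrow> 'n"
  assumes Fo_Ob: "x \<in> Ob C \<Longrightarrow> Fo x \<in> Ob D"
    and Fm_Hom: "\<lbrakk>x \<in> Ob C; y \<in> Ob C; f \<in> Hom C x y\<rbrakk> \<Longrightarrow> Fm x y f \<in> Hom D (Fo x) (Fo y)"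
    and Fm_Idn: "x \<in> Ob C \<Longrightarrow> Fm x x (Idn C x) = Idn D (Fo x)"
    and Fm_Cmp: "\<lbrakk>x \<in> Ob C; y \<in> Ob C; z \<in> Ob C; f \<in> Hom C x y; g \<in> Hom C y z\<rbrakk> \<Longrightarrow>
      Fm x z (Cmp C x y z g f) = Cmp D (Fo x) (Fo y) (Fo z) (Fm y z g) (Fm x y f)"

text \<open>The types of the cells play the role of the universe of small sets.\<close>

definition Set_Cat :: "('v set, 'v \<Rightarrow> 'v) category" where
  "Set_Cat = \<lparr>Ob = UNIV, Hom = (\<lambda>A B. A \<rightarrow>\<^sub>E B), Idn = (\<lambda>A. \<lambda>x\<in>A. x),
    Cmp = (\<lambda>A B C g f. compose A g f)\<rparr>"

definition Tame_Omega_Cat ::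
  "(('a, 'b, 'c) weak_omega_category, ('a, 'b, 'c, 'a, 'b, 'c) omega_maps) category" where
  "Tame_Omega_Cat =
    \<lparr>Ob = {X. weak_omega_category X},
     Hom = (\<lambda>X Y. {F. omega_pseudo_functor X Y F \<and> tame X Y F}),
     Idn = (\<lambda>X. (gid (mag1 X), gid (mag2 X), gid (mag3 X))),
     Cmp = (\<lambda>X Y Z (G1, G2, G3) (F1, F2, F3).
       (gcompose (mag1 X) G1 F1, gcompose (mag2 X) G2 F2, gcompose (mag3 X) G3 F3))\<rparr>"

definition Pi_obj :: "('a, 'b, 'c) weak_omega_category \<Rightarrow> 'a set set" where
  "Pi_obj X = cells (mag1 X) 0 // equivalent_cells X 0"

text \<open>
  A class \<open>A\<close> is sent to the set of \<open>0\<close>-cells equivalent to some \<open>F\<^sub>1 x\<close> with \<open>x \<in> A\<close>, which is the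
  class of \<open>F\<^sub>1 x\<close> for any \<open>x \<in> A\<close> once \<open>F\<^sub>1\<close> is known to respect equivalence.
\<close>

definition Pi_arr :: "('a, 'b, 'c) weak_omega_category \<Rightarrow> ('d, 'e, 'f) weak_omega_category \<Rightarrow>
    ('a, 'b, 'c, 'd, 'e, 'f) omega_maps \<Rightarrow> 'a set \<Rightarrow> 'd set" where
  "Pi_arr X Y F = (\<lambda>A\<in>Pi_obj X. equivalent_cells Y 0 `` (fst F 0 ` A))"

end

theory Submission
  imports Defs
begin

text \<open>
  The substance of the theorem lies in two facts.

  First, \<open>\<approx>\<close> is an equivalence relation. Identity cells are elementary internal equivalences, and
  each stage of the construction of the internal equivalences is closed under composites, which
  gives reflexivity and transitivity. For symmetry one shows, stage by stage, that every internal
  equivalence has an internal equivalence in the opposite direction (\<open>equiv_stage_reversible\<close>). At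
  the bottom this comes from the automorphism of \<open>Cl(2)\<close> that swaps the two generating points:
  precomposing with it a morphism that sends \<open>c(1,2)\<close> to \<open>f\<close> yields one that sends \<open>c(1,2)\<close> to a
  cell in the opposite direction. Composites are reversed by composing the reversed factors, and
  the condition that makes \<open>f\<close> invertible up to cells of a given stage is symmetric in \<open>f\<close> and its
  weak inverse.

  Second, omega pseudo-functors compose, although they preserve composites only after applying
  \<open>\<kappa>\<close>. For pseudo-functors \<open>F : X \<rightarrow> Y\<close> and \<open>G : Y \<rightarrow> Z\<close>,
  \<open>\<kappa>(G\<^sub>2F\<^sub>2a \<circ> G\<^sub>2F\<^sub>2b) = \<kappa>G\<^sub>2(F\<^sub>2a \<circ> F\<^sub>2b) = G\<^sub>3\<kappa>(F\<^sub>2a \<circ> F\<^sub>2b) = G\<^sub>3\<kappa>F\<^sub>2(a \<circ> b) = \<kappa>G\<^sub>2F\<^sub>2(a \<circ> b)\<close>,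
  so the third component is what carries the comparison of \<open>F\<close> along \<open>G\<close>.

  A tame pseudo-functor preserves boundaries and internal equivalences of the first magma, hence
  \<open>\<approx>\<close>, and so induces a map on classes; functoriality is then checked on representatives.
\<close>

section \<open>Morphisms of globular sets and their composition\<close>

lemma itdom_refl: "itdom X i i a = a" and itcod_refl: "itcod X i i a = a"
  by (cases i; simp)+

lemma composable_Suc:
  "composable X i (Suc i) a b \<longleftrightarrow>
    a \<in> cells X (Suc i) \<and> b \<in> cells X (Suc i) \<and> gcod X i a = gdom X i b"
  by (simp add: composable_def itdom_refl itcod_refl)

lemma globular_homD:
  assumes "F \<in> globular_hom X Y"
  shows "F i \<in> cells X i \<rightarrow>\<^sub>E cells Y i"
    and "a \<in> cells X i \<Longrightarrow> F i a \<in> cells Y i"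
    and "a \<in> cells X (Suc i) \<Longrightarrow> F i (gdom X i a) = gdom Y i (F (Suc i) a)"
    and "a \<in> cells X (Suc i) \<Longrightarrow> F i (gcod X i a) = gcod Y i (F (Suc i) a)"
  using assms unfolding globular_hom_def by auto

lemma globular_hom_itdom:
  assumes "globular_set X" "F \<in> globular_hom X Y"
  shows "i \<le> j \<Longrightarrow> a \<in> cells X j \<Longrightarrow> F i (itdom X i j a) = itdom Y i j (F j a)"
  by (induction j arbitrary: a)
    (auto simp: globular_homD(3)[OF assms(2)] globular_set.gdom_closed[OF assms(1)] le_Suc_eq)

lemma globular_hom_itcod:
  assumes "globular_set X" "F \<in> globular_hom X Y"
  shows "i \<le> j \<Longrightarrow> a \<in> cells X j \<Longrightarrow> F i (itcod X i j a) = itcod Y i j (F j a)"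
  by (induction j arbitrary: a)
    (auto simp: globular_homD(4)[OF assms(2)] globular_set.gcod_closed[OF assms(1)] le_Suc_eq)

lemma globular_hom_composable:
  assumes "globular_set X" "F \<in> globular_hom X Y" "composable X i j a b"
  shows "composable Y i j (F j a) (F j b)"
  using assms(3) globular_hom_itdom[OF assms(1,2), of i j b] globular_hom_itcod[OF assms(1,2), of i j a]
  by (auto simp: composable_def globular_homD(2)[OF assms(2)])

lemma gcompose_apply: "a \<in> cells X i \<Longrightarrow> gcompose X G F i a = G i (F i a)"
  by (simp add: gcompose_def compose_def)

lemma gid_apply: "a \<in> cells X i \<Longrightarrow> gid X i a = a"
  by (simp add: gid_def)

lemma gcompose_globular_hom:
  assumes X: "globular_set X" and F: "F \<in> globular_hom X Y" and G: "G \<in> globular_hom Y Z"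
  shows "gcompose X G F \<in> globular_hom X Z"
proof -
  have "gcompose X G F i \<in> cells X i \<rightarrow>\<^sub>E cells Z i" for i
    using globular_homD(2)[OF F] globular_homD(2)[OF G] by (auto simp: gcompose_def compose_def)
  then show ?thesis
    using globular_homD(2-4)[OF F] globular_homD(2-4)[OF G]
      globular_set.gdom_closed[OF X] globular_set.gcod_closed[OF X]
    unfolding globular_hom_def by (simp add: gcompose_apply)
qed

lemma gid_globular_hom: "globular_set X \<Longrightarrow> gid X \<in> globular_hom X X"
  by (auto simp: globular_hom_def gid_def globular_set.gdom_closed globular_set.gcod_closed)

lemma gcompose_assoc:
  "F \<in> globular_hom X Y \<Longrightarrow> gcompose X (gcompose Y H G) F = gcompose X H (gcompose X G F)"
  by (intro HOL.ext) (auto simp: gcompose_def compose_def dest: globular_homD(2))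

lemma gcompose_gid_left:
  assumes "F \<in> globular_hom X Y"
  shows "gcompose X (gid Y) F = F"
proof
  fix i
  show "gcompose X (gid Y) F i = F i"
    using globular_homD(1)[OF assms, of i] unfolding gcompose_def gid_def
    by (intro Id_compose) (auto simp: PiE_def)
qed

lemma gcompose_gid_right:
  assumes "F \<in> globular_hom X Y"
  shows "gcompose X F (gid X) = F"
proof
  fix i
  show "gcompose X F (gid X) i = F i"
    using globular_homD(1)[OF assms, of i] unfolding gcompose_def gid_def
    by (intro compose_Id) (auto simp: PiE_def)
qed

lemma gcompose_omega_graph_hom:
  assumes X: "omega_graph X" and F: "F \<in> omega_graph_hom X Y" and G: "G \<in> omega_graph_hom Y Z"
  shows "gcompose X G F \<in> omega_graph_hom X Z"
proof -
  have F': "F \<in> globular_hom X Y" and G': "G \<in> globular_hom Y Z"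
    using F G by (auto simp: omega_graph_hom_def)
  have "gcompose X G F (Suc i) (ident X i a) = ident Z i (gcompose X G F i a)"
    if "a \<in> cells X i" for i a
    using that F G globular_homD(2)[OF F' that] omega_graph.ident_closed[OF X that]
    by (simp add: gcompose_apply omega_graph_hom_def)
  then show ?thesis
    using gcompose_globular_hom[OF omega_graph.axioms(1)[OF X] F' G']
    by (simp add: omega_graph_hom_def)
qed

lemma gcompose_omega_magma_hom:
  assumes X: "omega_magma X" and F: "F \<in> omega_magma_hom X Y" and G: "G \<in> omega_magma_hom Y Z"
  shows "gcompose X G F \<in> omega_magma_hom X Z"
proof -
  have X': "omega_graph X" by (rule omega_magma.axioms(1)[OF X])
  have F': "F \<in> omega_graph_hom X Y" and G': "G \<in> omega_graph_hom Y Z"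
    and F'': "F \<in> globular_hom X Y"
    using F G by (auto simp: omega_graph_hom_def omega_magma_hom_def)
  have "gcompose X G F j (mcomp X i j a b) = mcomp Z i j (gcompose X G F j a) (gcompose X G F j b)"
    if ab: "composable X i j a b" for i j a b
  proof -
    have "a \<in> cells X j" "b \<in> cells X j" using ab by (auto simp: composable_def)
    then show ?thesis
      using ab F G omega_magma.mcomp_closed[OF X ab]
        globular_hom_composable[OF omega_graph.axioms(1)[OF X'] F'' ab]
      by (simp add: gcompose_apply omega_magma_hom_def)
  qed
  then show ?thesis
    using gcompose_omega_graph_hom[OF X' F' G'] by (simp add: omega_magma_hom_def)
qed

section \<open>The category of weak omega categories and pseudo-functors\<close>

lemma (in weak_omega_category) underlying_globular_sets:
  "globular_set (mag1 X)" "globular_set (mag2 X)" "globular_set (mag3 X)"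
  using mag1 mag2 mag3
  by (auto dest: strict_omega_category.axioms(1) omega_magma.axioms(1) omega_graph.axioms(1))

lemma (in weak_omega_category) structure_globular_homs:
  "lam X \<in> globular_hom (mag2 X) (mag1 X)" "kap X \<in> globular_hom (mag2 X) (mag3 X)"
  using lam kap
  by (auto simp: categorical_Penon_morphism_def bridge_hom_def omega_magma_hom_def
      omega_graph_hom_def)

lemma gid_omega_pseudo_functor:
  assumes "weak_omega_category X"
  shows "omega_pseudo_functor X X (gid (mag1 X), gid (mag2 X), gid (mag3 X))"
proof -
  interpret X: weak_omega_category X by fact
  have g3: "omega_graph (mag3 X)"
    using X.mag3 by (auto dest: strict_omega_category.axioms(1) omega_magma.axioms(1))
  have "gid (mag3 X) \<in> omega_graph_hom (mag3 X) (mag3 X)"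
    using gid_globular_hom[OF X.underlying_globular_sets(3)] omega_graph.ident_closed[OF g3]
    by (simp add: omega_graph_hom_def gid_apply)
  moreover have "kap X (Suc j) (mcomp (mag2 X) j (Suc j)
        (gid (mag2 X) (Suc j) a) (gid (mag2 X) (Suc j) b)) =
      kap X (Suc j) (gid (mag2 X) (Suc j) (mcomp (mag2 X) j (Suc j) a b))"
    if ab: "composable (mag2 X) j (Suc j) a b" for j a b
  proof -
    have "a \<in> cells (mag2 X) (Suc j)" "b \<in> cells (mag2 X) (Suc j)"
      using ab by (auto simp: composable_def)
    then show ?thesis using omega_magma.mcomp_closed[OF X.mag2 ab] by (simp add: gid_apply)
  qed
  ultimately show ?thesis
    unfolding omega_pseudo_functor_def
    using X.underlying_globular_sets
    by (simp add: gid_globular_hom gcompose_gid_left[OF X.structure_globular_homs(1)]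
        gcompose_gid_left[OF X.structure_globular_homs(2)]
        gcompose_gid_right[OF X.structure_globular_homs(1)]
        gcompose_gid_right[OF X.structure_globular_homs(2)])
qed

text \<open>
  Applied with \<open>l = \<lambda>\<close> and with \<open>l = \<kappa>\<close>, this gives the two commuting squares of a composite of
  pseudo-functors. No associativity is available for the function composition with its domain
  restrictions unless the inner map lands in the cells, hence the two membership hypotheses.
\<close>

lemma gcompose_square_paste:
  assumes "l \<in> globular_hom A B" "F \<in> globular_hom A A'"
    and "gcompose A F' l = gcompose A l' F" "gcompose A' G' l' = gcompose A' l'' G"
  shows "gcompose A (gcompose B G' F') l = gcompose A l'' (gcompose A G F)"
proof -
  have "gcompose A (gcompose B G' F') l = gcompose A G' (gcompose A l' F)"
    using assms(3) by (simp add: gcompose_assoc[OF assms(1)])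
  also have "\<dots> = gcompose A (gcompose A' l'' G) F"
    using assms(4) gcompose_assoc[OF assms(2), of G' l'] by simp
  finally show ?thesis by (simp add: gcompose_assoc[OF assms(2)])
qed

text \<open>
  Weak preservation of composites passes to the composite because \<open>\<kappa>\<close> and \<open>G\<^sub>3\<close> translate the
  comparison for \<open>F\<close>, which takes place in \<open>Y\<^sub>3\<close>, into one in \<open>Z\<^sub>3\<close> (the fact \<open>slide\<close>).
\<close>

lemma gcompose_omega_pseudo_functor:
  assumes X: "weak_omega_category X" and Y: "weak_omega_category Y" and Z: "weak_omega_category Z"
    and F: "omega_pseudo_functor X Y (F1, F2, F3)" and G: "omega_pseudo_functor Y Z (G1, G2, G3)"
  shows "omega_pseudo_functor X Z
    (gcompose (mag1 X) G1 F1, gcompose (mag2 X) G2 F2, gcompose (mag3 X) G3 F3)"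
proof -
  interpret X: weak_omega_category X by fact
  interpret Y: weak_omega_category Y by fact
  note Fs = F[unfolded omega_pseudo_functor_def prod.case]
  note Gs = G[unfolded omega_pseudo_functor_def prod.case]
  have F2: "F2 \<in> globular_hom (mag2 X) (mag2 Y)" using Fs by blast
  have G3: "omega_graph (mag3 X)"
    using X.mag3 by (auto dest: strict_omega_category.axioms(1) omega_magma.axioms(1))
  have slide: "kap Z i (G2 i y) = G3 i (kap Y i y)" if "y \<in> cells (mag2 Y) i" for i y
  proof -
    have "gcompose (mag2 Y) G3 (kap Y) i y = gcompose (mag2 Y) (kap Z) G2 i y" using Gs by simp
    then show ?thesis using that by (simp add: gcompose_apply)
  qed
  have "kap Z (Suc j) (mcomp (mag2 Z) j (Suc j)
          (gcompose (mag2 X) G2 F2 (Suc j) a) (gcompose (mag2 X) G2 F2 (Suc j) b)) =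
        kap Z (Suc j) (gcompose (mag2 X) G2 F2 (Suc j) (mcomp (mag2 X) j (Suc j) a b))"
    if ab: "composable (mag2 X) j (Suc j) a b" for j a b
  proof -
    have cells: "a \<in> cells (mag2 X) (Suc j)" "b \<in> cells (mag2 X) (Suc j)"
      using ab by (auto simp: composable_def)
    have ab': "composable (mag2 Y) j (Suc j) (F2 (Suc j) a) (F2 (Suc j) b)"
      by (rule globular_hom_composable[OF X.underlying_globular_sets(2) F2 ab])
    note c = omega_magma.mcomp_closed[OF X.mag2 ab]
    note c' = omega_magma.mcomp_closed[OF Y.mag2 ab']
    have "kap Z (Suc j) (mcomp (mag2 Z) j (Suc j) (G2 (Suc j) (F2 (Suc j) a)) (G2 (Suc j) (F2 (Suc j) b)))
        = kap Z (Suc j) (G2 (Suc j) (mcomp (mag2 Y) j (Suc j) (F2 (Suc j) a) (F2 (Suc j) b)))"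
      using Gs ab' by blast
    also have "\<dots> = G3 (Suc j) (kap Y (Suc j) (F2 (Suc j) (mcomp (mag2 X) j (Suc j) a b)))"
      unfolding slide[OF c'] using Fs ab by simp
    also have "\<dots> = kap Z (Suc j) (G2 (Suc j) (F2 (Suc j) (mcomp (mag2 X) j (Suc j) a b)))"
      by (rule slide[symmetric, OF globular_homD(2)[OF F2 c]])
    finally show ?thesis using cells c by (simp add: gcompose_apply)
  qed
  then show ?thesis
    unfolding omega_pseudo_functor_def prod.case
    using Fs Gs X.underlying_globular_sets G3
      gcompose_square_paste[OF X.structure_globular_homs(1) F2]
      gcompose_square_paste[OF X.structure_globular_homs(2) F2]
    by (intro conjI) (blast intro: gcompose_globular_hom gcompose_omega_graph_hom)+
qed

section \<open>Internal equivalences form a reversible, composition-closed graded set\<close>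

lemma elementary_equivs_subset_cells: "elementary_equivs M k \<subseteq> cells M k"
  by (cases "(M, k)" rule: elementary_equivs.cases) auto

lemma inv_cells_subset_cells: "inv_cells M S k \<subseteq> cells M k"
  by (cases k) auto

context omega_magma
begin

lemma comp_closure_subset_cells:
  assumes "S k \<subseteq> cells X k"
  shows "comp_closure X S k \<subseteq> cells X k"
proof
  fix a assume "a \<in> comp_closure X S k"
  then show "a \<in> cells X k"
    by (induction rule: comp_closure.induct) (use assms mcomp_closed in auto)
qed

lemma equiv_stage_subset_cells: "equiv_stage X i k \<subseteq> cells X k"
proof (induction i arbitrary: k)
  case 0
  then show ?case
    by (simp add: comp_closure_subset_cells elementary_equivs_subset_cells)
next
  case (Suc i)
  have "equiv_stage X i k \<union> inv_cells X (equiv_stage X i) k \<subseteq> cells X k"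
    using Suc inv_cells_subset_cells[of X] by blast
  then show ?case by (simp add: comp_closure_subset_cells)
qed

lemma internal_equivs_subset_cells: "internal_equivs X k \<subseteq> cells X k"
  using equiv_stage_subset_cells by (auto simp: internal_equivs_def)

lemma equiv_stage_mono: "i \<le> j \<Longrightarrow> equiv_stage X i k \<subseteq> equiv_stage X j k"
  by (induction rule: dec_induct) (auto intro: comp_closure.base)

lemma equiv_stage_mcomp:
  assumes "a \<in> equiv_stage X n k" "b \<in> equiv_stage X n k" "composable X i k a b"
  shows "mcomp X i k a b \<in> equiv_stage X n k"
  using assms by (cases n) (auto intro: comp_closure.step)

lemma internal_equivs_mcomp:
  assumes "a \<in> internal_equivs X k" "b \<in> internal_equivs X k" "composable X i k a b"
  shows "mcomp X i k a b \<in> internal_equivs X k"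
proof -
  obtain m n where "a \<in> equiv_stage X m k" "b \<in> equiv_stage X n k"
    using assms(1,2) by (auto simp: internal_equivs_def)
  then have "a \<in> equiv_stage X (max m n) k" "b \<in> equiv_stage X (max m n) k"
    using equiv_stage_mono[of m "max m n" k] equiv_stage_mono[of n "max m n" k] by auto
  then show ?thesis
    unfolding internal_equivs_def using equiv_stage_mcomp[OF _ _ assms(3)] by blast
qed

lemma ident_internal_equiv:
  assumes a: "a \<in> cells X k"
  shows "ident X k a \<in> internal_equivs X (Suc k)"
proof -
  have "ident X k a \<in> elementary_equivs X (Suc k)"
  proof (cases k)
    case 0
    then show ?thesis using ident_closed[OF a] a by simp
  next
    case (Suc n)
    then show ?thesis using ident_closed[OF a] a by simp
  qed
  then have "ident X k a \<in> equiv_stage X 0 (Suc k)"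
    unfolding equiv_stage.simps by (rule comp_closure.base)
  then show ?thesis unfolding internal_equivs_def by blast
qed

end

text \<open>
  Symmetry of \<open>\<approx>\<close> as a property of a set of cells one dimension up. In this form it can be
  carried through the stages of the construction.
\<close>

definition reversible :: "('a, 'z) globular_set_scheme \<Rightarrow> nat \<Rightarrow> 'a set \<Rightarrow> bool" where
  "reversible X n S \<longleftrightarrow> (\<forall>f\<in>S. \<exists>g\<in>S. gdom X n g = gcod X n f \<and> gcod X n g = gdom X n f)"

text \<open>
  The universal property, applied to the transposition of the points of \<open>K(2)\<close>, produces the swap;
  that it preserves bridges forces its value on \<open>c(1,2)\<close>, since bridge cells are determined by
  their boundary.
\<close>

lemma Cl2_swap:
  obtains \<sigma> where "\<sigma> \<in> omega_magma_hom Cl2 Cl2" "\<sigma> 1 (cl2_arrow One Two) = cl2_arrow Two One"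
proof -
  define sw where "sw p = (case p of One \<Rightarrow> Two | Two \<Rightarrow> One)" for p
  define f where "f n p = K2_to_Cl2 n (sw p)" for n p
  have K2_Suc: "K2_to_Cl2 (Suc n) p = Bridge (K2_to_Cl2 n p) (K2_to_Cl2 n p)" for n p
    by (simp add: K2_to_Cl2_def)
  have "K2_to_Cl2 n p \<in> cells Cl2 n" for n p
    by (induction n) (simp_all add: K2_Suc, simp add: K2_to_Cl2_def)
  then have f: "f \<in> omega_graph_hom K2 Cl2"
    by (simp add: omega_graph_hom_def globular_hom_def K2_def f_def K2_Suc PiE_UNIV_domain)
  obtain \<sigma> where \<sigma>: "\<sigma> \<in> bridge_hom Cl2 Cl2_bridge Cl2 Cl2_bridge"
    and ext: "gcompose K2 \<sigma> K2_to_Cl2 = f"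
    using ex1_implies_ex[OF omega_clique.Cl2_universal[OF Cl2_omega_clique f]] by (elim exE conjE)
  have pt: "\<sigma> 0 (Point p) = Point (sw p)" for p
  proof -
    have "gcompose K2 \<sigma> K2_to_Cl2 0 p = f 0 p" using ext by simp
    then show ?thesis by (simp add: gcompose_def compose_def K2_def f_def K2_to_Cl2_def)
  qed
  have "(Point One, Point Two, cl2_arrow One Two) \<in> Cl2_bridge 0"
    by (simp add: Cl2_bridge_def parallel_Cl2 cl2_arrow_def)
  then have "(\<sigma> 0 (Point One), \<sigma> 0 (Point Two), \<sigma> (Suc 0) (cl2_arrow One Two)) \<in> Cl2_bridge 0"
    using \<sigma> unfolding bridge_hom_def by blast
  then have "\<sigma> 1 (cl2_arrow One Two) = cl2_arrow Two One"
    by (simp add: pt sw_def Cl2_bridge_def cl2_arrow_def)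
  moreover have "\<sigma> \<in> omega_magma_hom Cl2 Cl2" using \<sigma> by (simp add: bridge_hom_def)
  ultimately show ?thesis by (rule that[rotated])
qed

text \<open>
  The second alternative in the definition of an elementary internal equivalence, with the magma
  as a parameter, so that dimension \<open>1\<close> and the higher dimensions, which use hom magmas, are
  treated alike.
\<close>

definition Cl2_arrow_images :: "('a, 'z) omega_magma_scheme \<Rightarrow> 'a set" where
  "Cl2_arrow_images M = {f. \<exists>H\<in>omega_magma_hom Cl2 M. H 1 (cl2_arrow One Two) = f}"

text \<open>
  If \<open>H\<close> sends \<open>c(1,2)\<close> to \<open>f\<close>, then \<open>H(c(2,1))\<close> goes in the opposite direction, and it is the image
  of \<open>c(1,2)\<close> under the composite of \<open>H\<close> with the swap.
\<close>

lemma Cl2_arrow_image_reverse: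
  assumes "f \<in> Cl2_arrow_images M"
  shows "\<exists>g. g \<in> Cl2_arrow_images M \<and> g \<in> cells M 1 \<and>
    gdom M 0 g = gcod M 0 f \<and> gcod M 0 g = gdom M 0 f"
proof -
  obtain H where H: "H \<in> omega_magma_hom Cl2 M" and f: "H 1 (cl2_arrow One Two) = f"
    using assms by (auto simp: Cl2_arrow_images_def)
  obtain \<sigma> where \<sigma>: "\<sigma> \<in> omega_magma_hom Cl2 Cl2" "\<sigma> 1 (cl2_arrow One Two) = cl2_arrow Two One"
    by (rule Cl2_swap)
  have arr: "cl2_arrow p q \<in> cells Cl2 1" for p q by (simp add: cl2_arrow_def)
  have Hg: "H \<in> globular_hom Cl2 M"
    using H by (simp add: omega_magma_hom_def omega_graph_hom_def)
  have bd: "gdom M 0 (H 1 (cl2_arrow p q)) = H 0 (Point p)"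
    "gcod M 0 (H 1 (cl2_arrow p q)) = H 0 (Point q)" for p q
    using globular_homD(3,4)[OF Hg arr[of p q, unfolded One_nat_def]] by (simp_all add: cl2_arrow_def)
  have "gcompose Cl2 H \<sigma> \<in> omega_magma_hom Cl2 M"
    by (rule gcompose_omega_magma_hom[OF omega_clique.axioms(1)[OF Cl2_omega_clique] \<sigma>(1) H])
  moreover have "gcompose Cl2 H \<sigma> 1 (cl2_arrow One Two) = H 1 (cl2_arrow Two One)"
    unfolding gcompose_apply[OF arr] \<sigma>(2) ..
  ultimately have "H 1 (cl2_arrow Two One) \<in> Cl2_arrow_images M"
    unfolding Cl2_arrow_images_def by blast
  moreover have "H 1 (cl2_arrow Two One) \<in> cells M 1"
    by (rule globular_homD(2)[OF Hg arr])
  ultimately show ?thesis using bd unfolding f[symmetric] by metis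
qed

context omega_magma
begin

lemma elementary_equivs_reversible: "reversible X n (elementary_equivs X (Suc n))"
  unfolding reversible_def
proof
  fix f assume f: "f \<in> elementary_equivs X (Suc n)"
  show "\<exists>g\<in>elementary_equivs X (Suc n). gdom X n g = gcod X n f \<and> gcod X n g = gdom X n f"
  proof (cases "f \<in> ident X n ` cells X n")
    case True
    then have "gdom X n f = gcod X n f" by (auto simp: gdom_ident gcod_ident)
    then show ?thesis using f by (intro bexI[of _ f]) simp_all
  next
    case nonid: False
    show ?thesis
    proof (cases n)
      case 0
      have el: "x \<in> elementary_equivs X (Suc n) \<longleftrightarrow> x \<in> cells X 1 \<and>
          (x \<in> ident X n ` cells X n \<or> x \<in> Cl2_arrow_images X)" for x
        unfolding 0 elementary_equivs.simps Cl2_arrow_images_def mem_Collect_eq ..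
      have "f \<in> Cl2_arrow_images X" using f nonid el[of f] by blast
      then obtain g where "g \<in> Cl2_arrow_images X" "g \<in> cells X 1"
        "gdom X 0 g = gcod X 0 f" "gcod X 0 g = gdom X 0 f"
        using Cl2_arrow_image_reverse[of f X] by blast
      then show ?thesis using el[of g] unfolding 0 by blast
    next
      case (Suc m)
      define N where "N x = hom_magma X m (itdom X m (Suc (Suc m)) x) (itcod X m (Suc (Suc m)) x)" for x
      have el: "x \<in> elementary_equivs X (Suc n) \<longleftrightarrow> x \<in> cells X (Suc (Suc m)) \<and>
          (x \<in> ident X n ` cells X n \<or> x \<in> Cl2_arrow_images (N x))" for x
        unfolding Suc elementary_equivs.simps Cl2_arrow_images_def mem_Collect_eq N_def ..
      have "f \<in> Cl2_arrow_images (N f)" using f nonid el[of f] by blast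
      then obtain g where g: "g \<in> Cl2_arrow_images (N f)" "g \<in> cells (N f) 1"
        "gdom (N f) 0 g = gcod (N f) 0 f" "gcod (N f) 0 g = gdom (N f) 0 f"
        using Cl2_arrow_image_reverse[of f "N f"] by blast
      have g_cell: "g \<in> cells X (Suc (Suc m))"
        and g_bd: "itdom X m (Suc (Suc m)) g = itdom X m (Suc (Suc m)) f"
          "itcod X m (Suc (Suc m)) g = itcod X m (Suc (Suc m)) f"
        using g(2) by (simp_all add: N_def hom_magma_def del: itdom.simps itcod.simps)
      \<comment> \<open>\<open>N g\<close> is the magma in which \<open>g\<close> is required to be an arrow image; it depends only on the
        iterated boundary of \<open>g\<close>, which reversal does not change.\<close>
      have "N g = N f" unfolding N_def g_bd ..
      then have "g \<in> elementary_equivs X (Suc n)" using g(1) g_cell el[of g] by metis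
      moreover have "gdom X n g = gcod X n f" "gcod X n g = gdom X n f"
        using g(3,4) unfolding Suc by (simp_all add: N_def hom_magma_def)
      ultimately show ?thesis by blast
    qed
  qed
qed

text \<open>
  A composite along the highest possible dimension is reversed by composing the reversed factors in
  the opposite order. A composite along a lower dimension is reversed factor by factor, in the same
  order, since reversal does not change boundaries below the top.
\<close>

lemma comp_closure_reversible:
  assumes S: "S (Suc n) \<subseteq> cells X (Suc n)" and rev: "reversible X n (S (Suc n))"
  shows "reversible X n (comp_closure X S (Suc n))"
  unfolding reversible_def
proof
  note cells = subsetD[OF comp_closure_subset_cells[of S, OF S]]
  fix f assume "f \<in> comp_closure X S (Suc n)"
  then show "\<exists>g\<in>comp_closure X S (Suc n). gdom X n g = gcod X n f \<and> gcod X n g = gdom X n f"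
  proof (induction rule: comp_closure.induct)
    case (base a)
    then show ?case using rev by (auto simp: reversible_def intro: comp_closure.base)
  next
    case (step a b i)
    obtain a' where a': "a' \<in> comp_closure X S (Suc n)" "gdom X n a' = gcod X n a"
      "gcod X n a' = gdom X n a" using step.IH by blast
    obtain b' where b': "b' \<in> comp_closure X S (Suc n)" "gdom X n b' = gcod X n b"
      "gcod X n b' = gdom X n b" using step.IH by blast
    note ab = \<open>composable X i (Suc n) a b\<close>
    note in_cells = cells[OF a'(1)] cells[OF b'(1)] cells[OF step.hyps(1)] cells[OF step.hyps(2)]
    show ?case
    proof (cases "i = n")
      case True
      have "composable X i (Suc n) b' a'"
        using ab in_cells a' b' True by (simp add: composable_Suc)
      then show ?thesis
        using ab True a' b' gdom_mcomp gcod_mcomp comp_closure.step[OF b'(1) a'(1)] by metis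
    next
      case False
      then have i: "i < n" using ab by (simp add: composable_def)
      then obtain m where n: "n = Suc m" by (cases n) auto
      have "itcod X i n (gdom X n a) = itcod X i n (gcod X n a)"
        "itdom X i n (gdom X n b) = itdom X i n (gcod X n b)"
        using in_cells i by (simp_all add: n gdom_glob gcod_glob)
      then have ab': "composable X i (Suc n) a' b'"
        using ab in_cells a' b' i by (simp add: composable_def)
      show ?thesis
        using comp_closure.step[OF a'(1) b'(1) ab'] a' b'
        by (intro bexI[of _ "mcomp X i (Suc n) a' b'"])
          (simp_all add: gdom_mcomp_less[OF _ i] gcod_mcomp_less[OF _ i] ab ab')
    qed
  qed
qed

text \<open>
  A weak inverse \<open>g\<close> of \<open>f\<close> has \<open>f\<close> as a weak inverse, with the roles of the cells \<open>h\<close> and \<open>h'\<close>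
  exchanged.
\<close>

lemma inv_cells_reversible: "reversible X n (inv_cells X S (Suc n))"
  unfolding reversible_def
proof
  fix f assume "f \<in> inv_cells X S (Suc n)"
  then obtain g h h' where fg: "f \<in> cells X (Suc n)" "g \<in> cells X (Suc n)"
      "gdom X n g = gcod X n f" "gcod X n g = gdom X n f"
    and h: "h \<in> S (Suc (Suc n))" "gdom X (Suc n) h = mcomp X n (Suc n) f g"
      "gcod X (Suc n) h = ident X n (gdom X n f)"
    and h': "h' \<in> S (Suc (Suc n))" "gdom X (Suc n) h' = mcomp X n (Suc n) g f"
      "gcod X (Suc n) h' = ident X n (gcod X n f)"
    by auto
  have "g \<in> inv_cells X S (Suc n)"
    unfolding inv_cells.simps mem_Collect_eq
    by (intro conjI bexI[of _ f] bexI[of _ h'] bexI[of _ h]) (simp_all add: fg h h')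
  then show "\<exists>g\<in>inv_cells X S (Suc n). gdom X n g = gcod X n f \<and> gcod X n g = gdom X n f"
    using fg by blast
qed

lemma equiv_stage_reversible: "reversible X n (equiv_stage X i (Suc n))"
proof (induction i)
  case 0
  then show ?case
    using comp_closure_reversible[of "elementary_equivs X"]
    by (simp add: elementary_equivs_subset_cells elementary_equivs_reversible)
next
  case (Suc i)
  let ?S = "\<lambda>k. equiv_stage X i k \<union> inv_cells X (equiv_stage X i) k"
  have "?S (Suc n) \<subseteq> cells X (Suc n)"
    using equiv_stage_subset_cells inv_cells_subset_cells[of X] by blast
  moreover have "reversible X n (?S (Suc n))"
    using Suc inv_cells_reversible[of n "equiv_stage X i"] unfolding reversible_def by blast
  ultimately show ?case
    unfolding equiv_stage.simps by (rule comp_closure_reversible)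
qed

lemma internal_equivs_reversible: "reversible X n (internal_equivs X (Suc n))"
  unfolding reversible_def
proof
  fix f assume "f \<in> internal_equivs X (Suc n)"
  then obtain i where i: "f \<in> equiv_stage X i (Suc n)" by (auto simp: internal_equivs_def)
  have "equiv_stage X i (Suc n) \<subseteq> internal_equivs X (Suc n)" by (auto simp: internal_equivs_def)
  then show "\<exists>g\<in>internal_equivs X (Suc n). gdom X n g = gcod X n f \<and> gcod X n g = gdom X n f"
    using i equiv_stage_reversible[of n i] unfolding reversible_def by blast
qed

end

lemma equivalent_cellsI:
  assumes "f \<in> internal_equivs (mag1 X) (Suc i)" "gdom (mag1 X) i f = a" "gcod (mag1 X) i f = b"
    and "a \<in> cells (mag1 X) i" "b \<in> cells (mag1 X) i"
  shows "(a, b) \<in> equivalent_cells X i"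
  using assms by (auto simp: equivalent_cells_def)

lemma equivalent_cellsE:
  assumes "(a, b) \<in> equivalent_cells X i"
  obtains f where "f \<in> internal_equivs (mag1 X) (Suc i)" "gdom (mag1 X) i f = a"
    "gcod (mag1 X) i f = b" "a \<in> cells (mag1 X) i" "b \<in> cells (mag1 X) i"
  using assms by (auto simp: equivalent_cells_def)

theorem (in weak_omega_category) equiv_equivalent_cells:
  "equiv (cells (mag1 X) i) (equivalent_cells X i)"
proof -
  interpret M: omega_magma "mag1 X" by (rule mag1)
  show ?thesis
  proof (rule equivI)
    show "equivalent_cells X i \<subseteq> cells (mag1 X) i \<times> cells (mag1 X) i"
      by (auto simp: equivalent_cells_def)
    show "refl_on (cells (mag1 X) i) (equivalent_cells X i)"
      by (rule refl_onI)
        (rule equivalent_cellsI[OF M.ident_internal_equiv M.gdom_ident M.gcod_ident])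
    show "sym (equivalent_cells X i)"
    proof (rule symI)
      fix a b assume "(a, b) \<in> equivalent_cells X i"
      then obtain f where f: "f \<in> internal_equivs (mag1 X) (Suc i)" "gdom (mag1 X) i f = a"
        "gcod (mag1 X) i f = b" "a \<in> cells (mag1 X) i" "b \<in> cells (mag1 X) i"
        by (rule equivalent_cellsE)
      then obtain g where "g \<in> internal_equivs (mag1 X) (Suc i)"
        "gdom (mag1 X) i g = b" "gcod (mag1 X) i g = a"
        using M.internal_equivs_reversible[of i] unfolding reversible_def by blast
      then show "(b, a) \<in> equivalent_cells X i" using f(4,5) by (intro equivalent_cellsI)
    qed
    show "trans (equivalent_cells X i)"
    proof (rule transI)
      fix a b c assume ab: "(a, b) \<in> equivalent_cells X i" and bc: "(b, c) \<in> equivalent_cells X i"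
      obtain f where f: "f \<in> internal_equivs (mag1 X) (Suc i)" "gdom (mag1 X) i f = a"
        "gcod (mag1 X) i f = b" "a \<in> cells (mag1 X) i"
        by (rule equivalent_cellsE[OF ab])
      obtain g where g: "g \<in> internal_equivs (mag1 X) (Suc i)" "gdom (mag1 X) i g = b"
        "gcod (mag1 X) i g = c" "c \<in> cells (mag1 X) i"
        by (rule equivalent_cellsE[OF bc])
      have fg: "composable (mag1 X) i (Suc i) f g"
        using f g M.internal_equivs_subset_cells by (auto simp: composable_Suc)
      show "(a, c) \<in> equivalent_cells X i"
        using M.internal_equivs_mcomp[OF f(1) g(1) fg] M.gdom_mcomp[OF fg] M.gcod_mcomp[OF fg]
          f(2,4) g(3,4)
        by (intro equivalent_cellsI) simp_all
    qed
  qed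
qed

section \<open>The functor of equivalence classes of 0-cells\<close>

lemma category_Tame_Omega_Cat:
  "category (Tame_Omega_Cat :: (('a, 'b, 'c) weak_omega_category, _) category)"
proof
  fix X :: "('a, 'b, 'c) weak_omega_category"
  assume "X \<in> Ob Tame_Omega_Cat"
  then interpret X: weak_omega_category X by (simp add: Tame_Omega_Cat_def)
  have "tame X X (gid (mag1 X), gid (mag2 X), gid (mag3 X))"
    by (auto simp: tame_def gid_apply[OF subsetD[OF omega_magma.internal_equivs_subset_cells[OF X.mag1]]])
  then show "Idn Tame_Omega_Cat X \<in> Hom Tame_Omega_Cat X X"
    using gid_omega_pseudo_functor[OF X.weak_omega_category_axioms] by (simp add: Tame_Omega_Cat_def)
next
  fix X Y Z :: "('a, 'b, 'c) weak_omega_category" and F G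
  assume "X \<in> Ob Tame_Omega_Cat" "Y \<in> Ob Tame_Omega_Cat" "Z \<in> Ob Tame_Omega_Cat"
    and FG: "F \<in> Hom Tame_Omega_Cat X Y" "G \<in> Hom Tame_Omega_Cat Y Z"
  then have w: "weak_omega_category X" "weak_omega_category Y" "weak_omega_category Z"
    by (simp_all add: Tame_Omega_Cat_def)
  obtain F1 F2 F3 G1 G2 G3 where eq: "F = (F1, F2, F3)" "G = (G1, G2, G3)"
    by (metis prod_cases3)
  have F: "omega_pseudo_functor X Y (F1, F2, F3)" "tame X Y (F1, F2, F3)"
    and G: "omega_pseudo_functor Y Z (G1, G2, G3)" "tame Y Z (G1, G2, G3)"
    using FG by (simp_all add: Tame_Omega_Cat_def eq)
  have "gcompose (mag1 X) G1 F1 k f \<in> internal_equivs (mag1 Z) k"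
    if "f \<in> internal_equivs (mag1 X) k" for k f
  proof -
    have "f \<in> cells (mag1 X) k"
      using that omega_magma.internal_equivs_subset_cells[OF weak_omega_category.mag1[OF w(1)]] by blast
    then show ?thesis using that F(2) G(2) by (simp add: tame_def gcompose_apply image_subset_iff)
  qed
  then have "tame X Z (gcompose (mag1 X) G1 F1, gcompose (mag2 X) G2 F2, gcompose (mag3 X) G3 F3)"
    by (auto simp: tame_def)
  then show "Cmp Tame_Omega_Cat X Y Z G F \<in> Hom Tame_Omega_Cat X Z"
    using gcompose_omega_pseudo_functor[OF w F(1) G(1)] by (simp add: Tame_Omega_Cat_def eq)
next
  fix X Y :: "('a, 'b, 'c) weak_omega_category" and F
  assume "F \<in> Hom Tame_Omega_Cat X Y"
  then show "Cmp Tame_Omega_Cat X Y Y (Idn Tame_Omega_Cat Y) F = F"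
    "Cmp Tame_Omega_Cat X X Y F (Idn Tame_Omega_Cat X) = F"
    by (auto simp: Tame_Omega_Cat_def omega_pseudo_functor_def
        intro: gcompose_gid_left gcompose_gid_right)
next
  fix W X Y Z :: "('a, 'b, 'c) weak_omega_category" and F G H
  assume "F \<in> Hom Tame_Omega_Cat W X"
  then show "Cmp Tame_Omega_Cat W X Z (Cmp Tame_Omega_Cat X Y Z H G) F =
      Cmp Tame_Omega_Cat W Y Z H (Cmp Tame_Omega_Cat W X Y G F)"
    by (auto simp: Tame_Omega_Cat_def omega_pseudo_functor_def
        intro: gcompose_assoc split: prod.split)
qed

lemma category_Set_Cat: "category Set_Cat"
proof
  fix A B C D :: "'v set" and f g h
  assume "f \<in> Hom Set_Cat A B" "g \<in> Hom Set_Cat B C"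
  then show "Cmp Set_Cat A B D (Cmp Set_Cat B C D h g) f =
      Cmp Set_Cat A C D h (Cmp Set_Cat A B C g f)"
    by (auto simp: Set_Cat_def intro!: compose_assoc[symmetric])
next
  fix A B :: "'v set" and f
  assume "f \<in> Hom Set_Cat A B"
  then have f: "f \<in> A \<rightarrow> B" "f \<in> extensional A" by (simp_all add: Set_Cat_def PiE_def)
  show "Cmp Set_Cat A B B (Idn Set_Cat B) f = f" "Cmp Set_Cat A A B f (Idn Set_Cat A) = f"
    using Id_compose[OF f] compose_Id[OF f] by (simp_all add: Set_Cat_def)
qed (auto simp: Set_Cat_def compose_def)

lemma tame_respects_equivalent_cells:
  assumes F: "F1 \<in> globular_hom (mag1 X) (mag1 Y)" and tame: "tame X Y (F1, F2, F3)"
    and X: "weak_omega_category X"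
    and ab: "(a, b) \<in> equivalent_cells X i"
  shows "(F1 i a, F1 i b) \<in> equivalent_cells Y i"
proof -
  obtain f where f: "f \<in> internal_equivs (mag1 X) (Suc i)" "gdom (mag1 X) i f = a"
    "gcod (mag1 X) i f = b" and cells: "a \<in> cells (mag1 X) i" "b \<in> cells (mag1 X) i"
    using ab by (rule equivalent_cellsE)
  have f': "f \<in> cells (mag1 X) (Suc i)"
    using omega_magma.internal_equivs_subset_cells[OF weak_omega_category.mag1[OF X]] f(1) by blast
  have "F1 (Suc i) f \<in> internal_equivs (mag1 Y) (Suc i)" using tame f(1) by (auto simp: tame_def)
  then show ?thesis
    using globular_homD(2)[OF F cells(1)] globular_homD(2)[OF F cells(2)]
      globular_homD(3,4)[OF F f'] f(2,3)
    by (intro equivalent_cellsI) simp_all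
qed

text \<open>
  All images \<open>F\<^sub>1 y\<close> of members \<open>y\<close> of the class of \<open>x\<close> lie in one class, so the union of classes by
  which the arrow part is defined is the class of \<open>F\<^sub>1 x\<close>.
\<close>

lemma Pi_arr_class:
  assumes X: "weak_omega_category X" and Y: "weak_omega_category Y"
    and F: "omega_pseudo_functor X Y (F1, F2, F3)" "tame X Y (F1, F2, F3)"
    and x: "x \<in> cells (mag1 X) 0"
  shows "Pi_arr X Y (F1, F2, F3) (equivalent_cells X 0 `` {x}) = equivalent_cells Y 0 `` {F1 0 x}"
proof -
  have F1: "F1 \<in> globular_hom (mag1 X) (mag1 Y)" using F(1) by (simp add: omega_pseudo_functor_def)
  note eX = weak_omega_category.equiv_equivalent_cells[OF X, of 0]
  note eY = weak_omega_category.equiv_equivalent_cells[OF Y, of 0]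
  have "(F1 0 x, F1 0 y) \<in> equivalent_cells Y 0" if "(x, y) \<in> equivalent_cells X 0" for y
    by (rule tame_respects_equivalent_cells[OF F1 F(2) X that])
  then have "equivalent_cells Y 0 `` {F1 0 y} = equivalent_cells Y 0 `` {F1 0 x}"
    if "(x, y) \<in> equivalent_cells X 0" for y
    using equiv_class_eq[OF eY] that by metis
  moreover have "(x, x) \<in> equivalent_cells X 0" using equiv_class_self[OF eX x] by simp
  ultimately have "equivalent_cells Y 0 `` (F1 0 ` (equivalent_cells X 0 `` {x})) =
      equivalent_cells Y 0 `` {F1 0 x}"
    by blast
  moreover have "equivalent_cells X 0 `` {x} \<in> Pi_obj X"
    unfolding Pi_obj_def by (rule quotientI[OF x])
  ultimately show ?thesis by (simp add: Pi_arr_def)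
qed

theorem theorem51:
  shows "category_functor
      (Tame_Omega_Cat :: (('a, 'b, 'c) weak_omega_category, _) category) Set_Cat Pi_obj Pi_arr
    \<and> (\<forall>X :: ('a, 'b, 'c) weak_omega_category. X \<in> Ob Tame_Omega_Cat \<longrightarrow>
        equiv (cells (mag1 X) 0) (equivalent_cells X 0))
    \<and> (\<forall>(X :: ('a, 'b, 'c) weak_omega_category) Y F1 F2 F3 x.
        X \<in> Ob Tame_Omega_Cat \<and> Y \<in> Ob Tame_Omega_Cat \<and>
        (F1, F2, F3) \<in> Hom Tame_Omega_Cat X Y \<and> x \<in> cells (mag1 X) 0 \<longrightarrow>
        Pi_arr X Y (F1, F2, F3) (equivalent_cells X 0 `` {x}) = equivalent_cells Y 0 `` {F1 0 x})"
proof (intro conjI allI impI)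
  let ?C = "Tame_Omega_Cat :: (('a, 'b, 'c) weak_omega_category, _) category"
  interpret C: category ?C by (rule category_Tame_Omega_Cat)
  have on_class: "Pi_arr X Y F (equivalent_cells X 0 `` {x}) = equivalent_cells Y 0 `` {fst F 0 x}"
    "fst F 0 x \<in> cells (mag1 Y) 0"
    if "X \<in> Ob ?C" "Y \<in> Ob ?C" "F \<in> Hom ?C X Y" "x \<in> cells (mag1 X) 0" for X Y F x
    using that Pi_arr_class[of X Y "fst F" "fst (snd F)" "snd (snd F)" x]
    by (auto simp: Tame_Omega_Cat_def omega_pseudo_functor_def intro: globular_homD(2))
  have ext: "Pi_arr X Y F \<in> extensional (Pi_obj X)" for X Y :: "('a, 'b, 'c) weak_omega_category" and F
    by (simp add: Pi_arr_def)
  have representative: "\<exists>x\<in>cells (mag1 X) 0. A = equivalent_cells X 0 `` {x}" if "A \<in> Pi_obj X"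
    for A and X :: "('a, 'b, 'c) weak_omega_category"
    using that unfolding Pi_obj_def by (auto elim: quotientE)
  show "category_functor ?C Set_Cat Pi_obj Pi_arr"
  proof (rule category_functor.intro[OF C.category_axioms category_Set_Cat], unfold_locales)
    fix X :: "('a, 'b, 'c) weak_omega_category"
    show "Pi_obj X \<in> Ob Set_Cat" by (simp add: Set_Cat_def)
    assume X: "X \<in> Ob ?C"
    show "Pi_arr X X (Idn ?C X) = Idn Set_Cat (Pi_obj X)"
    proof (rule extensionalityI[OF ext])
      show "Idn Set_Cat (Pi_obj X) \<in> extensional (Pi_obj X)" by (simp add: Set_Cat_def)
      fix A assume A: "A \<in> Pi_obj X"
      then obtain x where x: "x \<in> cells (mag1 X) 0" "A = equivalent_cells X 0 `` {x}"
        using representative by blast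
      have "fst (Idn ?C X) 0 x = x" using x by (simp add: Tame_Omega_Cat_def gid_apply)
      then show "Pi_arr X X (Idn ?C X) A = Idn Set_Cat (Pi_obj X) A"
        using on_class(1)[OF X X C.Idn_in_Hom[OF X] x(1)] x A by (simp add: Set_Cat_def)
    qed
  next
    fix X Y :: "('a, 'b, 'c) weak_omega_category" and F
    assume XYF: "X \<in> Ob ?C" "Y \<in> Ob ?C" "F \<in> Hom ?C X Y"
    have "Pi_arr X Y F A \<in> Pi_obj Y" if A: "A \<in> Pi_obj X" for A
    proof -
      obtain x where "x \<in> cells (mag1 X) 0" "A = equivalent_cells X 0 `` {x}"
        using representative[OF A] by blast
      then show ?thesis
        using on_class[OF XYF, of x] quotientI[of "fst F 0 x" "cells (mag1 Y) 0" "equivalent_cells Y 0"]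
        by (simp add: Pi_obj_def)
    qed
    then show "Pi_arr X Y F \<in> Hom Set_Cat (Pi_obj X) (Pi_obj Y)"
      using ext by (auto simp: Set_Cat_def PiE_def)
  next
    fix X Y Z :: "('a, 'b, 'c) weak_omega_category" and F G
    assume ob: "X \<in> Ob ?C" "Y \<in> Ob ?C" "Z \<in> Ob ?C" and FG: "F \<in> Hom ?C X Y" "G \<in> Hom ?C Y Z"
    show "Pi_arr X Z (Cmp ?C X Y Z G F) =
        Cmp Set_Cat (Pi_obj X) (Pi_obj Y) (Pi_obj Z) (Pi_arr Y Z G) (Pi_arr X Y F)"
    proof (rule extensionalityI[OF ext])
      show "Cmp Set_Cat (Pi_obj X) (Pi_obj Y) (Pi_obj Z) (Pi_arr Y Z G) (Pi_arr X Y F)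
          \<in> extensional (Pi_obj X)"
        by (simp add: Set_Cat_def)
      fix A assume A: "A \<in> Pi_obj X"
      then obtain x where x: "x \<in> cells (mag1 X) 0" "A = equivalent_cells X 0 `` {x}"
        using representative by blast
      have "fst (Cmp ?C X Y Z G F) 0 x = fst G 0 (fst F 0 x)"
        using x by (simp add: Tame_Omega_Cat_def gcompose_apply split: prod.split)
      then show "Pi_arr X Z (Cmp ?C X Y Z G F) A =
          Cmp Set_Cat (Pi_obj X) (Pi_obj Y) (Pi_obj Z) (Pi_arr Y Z G) (Pi_arr X Y F) A"
        using on_class(1)[OF ob(1,3) C.Cmp_in_Hom[OF ob FG] x(1)] on_class[OF ob(1,2) FG(1) x(1)]
          on_class(1)[OF ob(2,3) FG(2)] x A
        by (simp add: Set_Cat_def compose_def)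
    qed
  qed
next
  fix X :: "('a, 'b, 'c) weak_omega_category"
  assume "X \<in> Ob Tame_Omega_Cat"
  then show "equiv (cells (mag1 X) 0) (equivalent_cells X 0)"
    by (simp add: Tame_Omega_Cat_def weak_omega_category.equiv_equivalent_cells)
next
  fix X Y :: "('a, 'b, 'c) weak_omega_category" and F1 F2 F3 x
  assume "X \<in> Ob Tame_Omega_Cat \<and> Y \<in> Ob Tame_Omega_Cat \<and>
    (F1, F2, F3) \<in> Hom Tame_Omega_Cat X Y \<and> x \<in> cells (mag1 X) 0"
  then show "Pi_arr X Y (F1, F2, F3) (equivalent_cells X 0 `` {x}) = equivalent_cells Y 0 `` {F1 0 x}"
    by (simp add: Tame_Omega_Cat_def Pi_arr_class)
qed

end
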